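(* Let $\mathcal{A}$ and $\mathcal{B}$ be unital $C^*$-algebras with units denoted $I$, and let $\Phi:\mathcal{A}\to\mathcal{B}$ be a unital $n$-positive linear map for some $n\geq 3$. Then \[ \big|\Phi(AB)-\Phi(A)\Phi(B)\big| \leq \big\|\Phi(|A^*-\alpha I|^2)\big\|^{1/2}\,\big[\Phi(|B-\beta I|^2)\big]^{1/2} \] for all $A,B\in\mathcal{A}$ and all $\alpha,\beta\in\mathbb{C}$. In particular, \[ \big\|\Phi(AB)-\Phi(A)\Phi(B)\big\| \leq \inf_{\alpha\in\mathbb{C}}\|A-\alpha I\|\;\inf_{\beta\in\mathbb{C}}\|B-\beta I\|. \]
   Context: For an element $X$ of a $C^*$-algebra, $|X|=(X^*X)^{1/2}$. A linear map $\Phi$ is unital if $\Phi(I)=I$. It is $n$-positive if the map $M_n(\mathcal{A})\to M_n(\mathcal{B})$, $[a_{ij}]\mapsto[\Phi(a_{ij})]$, sends positive elements to positive elements. *)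

theory Defs
  imports Complex_Main
begin

class cstar_algebra = real_normed_algebra_1 + banach +
  fixes cs_scaleC :: "complex \<Rightarrow> 'a \<Rightarrow> 'a"
    and cs_adj :: "'a \<Rightarrow> 'a"
  assumes scaleC_of_real: "cs_scaleC (complex_of_real r) x = scaleR r x"
    and scaleC_add_right: "cs_scaleC c (x + y) = cs_scaleC c x + cs_scaleC c y"
    and scaleC_add_left: "cs_scaleC (c + d) x = cs_scaleC c x + cs_scaleC d x"
    and scaleC_scaleC: "cs_scaleC c (cs_scaleC d x) = cs_scaleC (c * d) x"
    and scaleC_one: "cs_scaleC 1 x = x"
    and scaleC_mult_left: "cs_scaleC c x * y = cs_scaleC c (x * y)"
    and scaleC_mult_right: "x * cs_scaleC c y = cs_scaleC c (x * y)"
    and norm_scaleC: "norm (cs_scaleC c x) = cmod c * norm x"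
    and adj_adj: "cs_adj (cs_adj x) = x"
    and adj_add: "cs_adj (x + y) = cs_adj x + cs_adj y"
    and adj_scaleC: "cs_adj (cs_scaleC c x) = cs_scaleC (cnj c) (cs_adj x)"
    and adj_mult: "cs_adj (x * y) = cs_adj y * cs_adj x"
    and cstar_identity: "norm (cs_adj x * x) = (norm x)\<^sup>2"

context cstar_algebra
begin

definition cs_invertible :: "'a \<Rightarrow> bool" where
  "cs_invertible a \<longleftrightarrow> (\<exists>b. a * b = 1 \<and> b * a = 1)"

definition cs_spectrum :: "'a \<Rightarrow> complex set" where
  "cs_spectrum a = {c. \<not> cs_invertible (a - cs_scaleC c 1)}"

definition cs_positive :: "'a \<Rightarrow> bool" where
  "cs_positive a \<longleftrightarrow> cs_adj a = a \<and> (\<forall>c\<in>cs_spectrum a. Im c = 0 \<and> Re c \<ge> 0)"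

definition cs_le :: "'a \<Rightarrow> 'a \<Rightarrow> bool" where
  "cs_le x y \<longleftrightarrow> cs_positive (y - x)"

definition cs_sqrt :: "'a \<Rightarrow> 'a" where
  "cs_sqrt a = (THE b. cs_positive b \<and> b * b = a)"

definition cs_abs :: "'a \<Rightarrow> 'a" where
  "cs_abs x = cs_sqrt (cs_adj x * x)"

subsection \<open>n x n matrices over the algebra, M_n(A); entries with indices < n matter\<close>

definition mat_mult :: "nat \<Rightarrow> (nat \<Rightarrow> nat \<Rightarrow> 'a) \<Rightarrow> (nat \<Rightarrow> nat \<Rightarrow> 'a) \<Rightarrow> nat \<Rightarrow> nat \<Rightarrow> 'a" where
  "mat_mult n M N = (\<lambda>i j. \<Sum>k<n. M i k * N k j)"

definition mat_unit :: "nat \<Rightarrow> nat \<Rightarrow> 'a" where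
  "mat_unit = (\<lambda>i j. if i = j then 1 else 0)"

definition mat_eq :: "nat \<Rightarrow> (nat \<Rightarrow> nat \<Rightarrow> 'a) \<Rightarrow> (nat \<Rightarrow> nat \<Rightarrow> 'a) \<Rightarrow> bool" where
  "mat_eq n M N \<longleftrightarrow> (\<forall>i<n. \<forall>j<n. M i j = N i j)"

definition mat_invertible :: "nat \<Rightarrow> (nat \<Rightarrow> nat \<Rightarrow> 'a) \<Rightarrow> bool" where
  "mat_invertible n M \<longleftrightarrow>
     (\<exists>N. mat_eq n (mat_mult n M N) mat_unit \<and> mat_eq n (mat_mult n N M) mat_unit)"

definition mat_spectrum :: "nat \<Rightarrow> (nat \<Rightarrow> nat \<Rightarrow> 'a) \<Rightarrow> complex set" where
  "mat_spectrum n M = {c. \<not> mat_invertible n (\<lambda>i j. M i j - cs_scaleC c (mat_unit i j))}"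

definition mat_positive :: "nat \<Rightarrow> (nat \<Rightarrow> nat \<Rightarrow> 'a) \<Rightarrow> bool" where
  "mat_positive n M \<longleftrightarrow>
     (\<forall>i<n. \<forall>j<n. M j i = cs_adj (M i j)) \<and>
     (\<forall>c\<in>mat_spectrum n M. Im c = 0 \<and> Re c \<ge> 0)"

end

definition complex_linear_map :: "('a::cstar_algebra \<Rightarrow> 'b::cstar_algebra) \<Rightarrow> bool" where
  "complex_linear_map \<Phi> \<longleftrightarrow>
     (\<forall>x y. \<Phi> (x + y) = \<Phi> x + \<Phi> y) \<and> (\<forall>c x. \<Phi> (cs_scaleC c x) = cs_scaleC c (\<Phi> x))"

definition unital_map :: "('a::cstar_algebra \<Rightarrow> 'b::cstar_algebra) \<Rightarrow> bool" where
  "unital_map \<Phi> \<longleftrightarrow> \<Phi> 1 = 1"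

definition n_positive :: "nat \<Rightarrow> ('a::cstar_algebra \<Rightarrow> 'b::cstar_algebra) \<Rightarrow> bool" where
  "n_positive n \<Phi> \<longleftrightarrow>
     (\<forall>M :: nat \<Rightarrow> nat \<Rightarrow> 'a. mat_positive n M \<longrightarrow> mat_positive n (\<lambda>i j. \<Phi> (M i j)))"

end

theory Submission
  imports Defs
begin

text \<open>The matrix \<open>[X\<^sub>i\<^sup>* X\<^sub>j]\<close> for \<open>X = (A\<^sup>*, B, I)\<close> is positive, hence so is its image under \<open>\<Phi>\<close>. The Schur
  complement of the entry \<open>\<Phi>(I) = I\<close> is a positive \<open>2 \<times> 2\<close> matrix with off-diagonal entry
  \<open>T = \<Phi>(AB) - \<Phi>(A)\<Phi>(B)\<close> and diagonal entries below \<open>\<Phi>(AA\<^sup>*)\<close> and \<open>\<Phi>(B\<^sup>* B)\<close>, so that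
  \<open>T\<^sup>* T\<close> is at most \<open>\<Phi>(B\<^sup>* B)\<close> times the norm of \<open>\<Phi>(AA\<^sup>*)\<close>. Shifting \<open>A\<close> and \<open>B\<close> by scalars does not
  change \<open>T\<close>, and the square root is operator monotone. No norm on matrices is needed: a hermitian
  matrix with nonnegative spectrum has a positive quadratic form by a continuity argument on the
  matrices \<open>M + t\<close>, \<open>t > 0\<close>.\<close>

subsection \<open>Involution, inverses and square roots by iteration\<close>

text \<open>Spectral positivity does not visibly survive sums or limits. It is therefore traded for
  being the square of a self-adjoint element, which for self-adjoint \<open>a\<close> and
  \<open>M \<ge> norm a\<close> amounts to \<open>norm (M *\<^sub>R 1 - a) \<le> M\<close>, a
  condition that respects both. Size 3 is what the Schur complement costs: two entries for the
  factors of the covariance and one for the unit, whose elimination subtracts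
  \<open>\<Phi> A * \<Phi> B\<close>.\<close>

lemma scaleC_zero [simp]: "cs_scaleC c (0::'a::cstar_algebra) = 0"
  by (metis norm_scaleC norm_eq_zero mult_zero_right)

lemma scaleC_minus_right [simp]: "cs_scaleC c (- x) = - cs_scaleC c (x::'a::cstar_algebra)"
  by (metis add.right_inverse add_eq_0_iff scaleC_add_right scaleC_zero)

lemma scaleC_zero_left [simp]: "cs_scaleC 0 (x::'a::cstar_algebra) = 0"
  by (metis norm_scaleC norm_eq_zero mult_zero_left)

lemma scaleC_minus_left [simp]: "cs_scaleC (- c) x = - cs_scaleC c (x::'a::cstar_algebra)"
  by (metis add.right_inverse add_eq_0_iff scaleC_add_left scaleC_zero_left)

lemma adj_scaleR [simp]: "cs_adj (r *\<^sub>R x) = r *\<^sub>R cs_adj (x::'a::cstar_algebra)"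
  by (metis scaleC_of_real adj_scaleC complex_cnj_complex_of_real)

lemma adj_zero [simp]: "cs_adj (0::'a::cstar_algebra) = 0"
  by (metis adj_scaleR scaleR_zero_left)

lemma adj_minus [simp]: "cs_adj (- x) = - cs_adj (x::'a::cstar_algebra)"
  by (metis adj_scaleR scaleR_minus1_left)

lemma adj_diff: "cs_adj (x - y) = cs_adj x - cs_adj (y::'a::cstar_algebra)"
  by (metis adj_add adj_minus add_uminus_conv_diff)

lemma adj_one [simp]: "cs_adj (1::'a::cstar_algebra) = 1"
  by (metis adj_adj adj_mult mult.left_neutral)

lemma adj_sum: "cs_adj (sum f S) = (\<Sum>i\<in>S. cs_adj (f i :: 'a::cstar_algebra))"
  by (induction S rule: infinite_finite_induct) (auto simp: adj_add)

lemma norm_adj [simp]: "norm (cs_adj x) = norm (x::'a::cstar_algebra)"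
proof -
  have le: "norm y \<le> norm (cs_adj y)" for y :: 'a
  proof -
    have "(norm y)\<^sup>2 \<le> norm (cs_adj y) * norm y"
      by (metis cstar_identity norm_mult_ineq)
    then show ?thesis
      by (cases "norm y = 0") (auto simp: power2_eq_square)
  qed
  from le[of x] le[of "cs_adj x"] show ?thesis by (simp add: adj_adj)
qed

lemma norm_square_sa: "cs_adj x = x \<Longrightarrow> norm (x * x) = (norm (x::'a::cstar_algebra))\<^sup>2"
  by (metis cstar_identity)

section \<open>Neumann series and the real spectrum of self-adjoint elements\<close>

lemma invertible_one_minus:
  fixes h :: "'a::cstar_algebra"
  assumes "norm h < 1"
  shows "cs_invertible (1 - h)"
proof -
  let ?s = "\<Sum>n. h ^ n"
  have s: "summable (\<lambda>n. h ^ n)"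
    using assms by (rule complete_algebra_summable_geometric)
  have sh: "?s = (\<Sum>n. h ^ Suc n) + 1"
    using suminf_split_head[OF s] by simp
  have "(\<Sum>n. h ^ Suc n) = h * ?s"
    using suminf_mult[OF s, of h] by simp
  moreover have "(\<Sum>n. h ^ Suc n) = ?s * h"
    using suminf_mult2[OF s, of h] by (simp only: power_Suc2)
  ultimately have "(1 - h) * ?s = 1" "?s * (1 - h) = 1"
    using sh by (simp_all add: algebra_simps)
  then show ?thesis unfolding cs_invertible_def by blast
qed

lemma invertible_scaleC:
  fixes y :: "'a::cstar_algebra"
  assumes "cs_invertible y" "d \<noteq> 0"
  shows "cs_invertible (cs_scaleC d y)"
proof -
  obtain z where "y * z = 1" "z * y = 1" using assms(1) unfolding cs_invertible_def by blast
  then have "cs_scaleC d y * cs_scaleC (inverse d) z = 1" "cs_scaleC (inverse d) z * cs_scaleC d y = 1"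
    using assms(2) by (simp_all add: scaleC_mult_left scaleC_mult_right scaleC_scaleC scaleC_one)
  then show ?thesis unfolding cs_invertible_def by blast
qed

lemma invertible_norm_less:
  fixes y :: "'a::cstar_algebra"
  assumes "norm y < cmod d"
  shows "cs_invertible (y - cs_scaleC d 1)"
proof -
  have d: "d \<noteq> 0" using assms by auto
  have "norm (cs_scaleC (inverse d) y) < 1"
    using assms d by (simp add: norm_scaleC norm_inverse norm_divide field_simps)
  then have "cs_invertible (cs_scaleC (- d) (1 - cs_scaleC (inverse d) y))"
    using d by (intro invertible_scaleC invertible_one_minus) auto
  moreover have "cs_scaleC (- d) (1 - cs_scaleC (inverse d) y) = y - cs_scaleC d 1"
    using d by (simp add: scaleC_scaleC scaleC_one scaleC_add_right
        flip: add_uminus_conv_diff)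
  ultimately show ?thesis by simp
qed

text \<open>Adding \<open>\<i> t\<close> moves \<open>c\<close> to \<open>c + \<i> t\<close>,
  whereas by the C*-identity the squared norm grows to at most
  \<open>(norm a)\<^sup>2 + t\<^sup>2\<close>. For a suitable \<open>t\<close> the moved point is
  larger than the norm and the Neumann series applies.\<close>

lemma sa_spectrum_real:
  fixes a :: "'a::cstar_algebra"
  assumes a: "cs_adj a = a" and c: "Im c \<noteq> 0"
  shows "cs_invertible (a - cs_scaleC c 1)"
proof -
  \<comment> \<open>Makes the cross term \<open>2 * t * Im c\<close> of the squared modulus equal to
    \<open>(norm a)\<^sup>2\<close>, so that \<open>(cmod c)\<^sup>2 > 0\<close> remains as the
    strict gap.\<close>
  define t where "t = (norm a)\<^sup>2 / (2 * Im c)"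
  define i where "i = cs_scaleC (\<i> * complex_of_real t) (1::'a)"
  have adji: "cs_adj i = - i"
    by (simp add: i_def adj_scaleC)
  have i2: "i * i = - (t\<^sup>2 *\<^sub>R 1)"
  proof -
    have "i * i = cs_scaleC (\<i> * complex_of_real t * (\<i> * complex_of_real t)) 1"
      by (simp add: i_def scaleC_mult_left scaleC_mult_right scaleC_scaleC)
    also have "\<i> * complex_of_real t * (\<i> * complex_of_real t) = complex_of_real (- t\<^sup>2)"
      by (simp add: complex_eq_iff power2_eq_square)
    finally show ?thesis
      by (simp only: scaleC_of_real scaleR_minus_left)
  qed
  have comm: "a * i = i * a"
    by (simp add: i_def scaleC_mult_left scaleC_mult_right)
  have "(norm (a + i))\<^sup>2 = norm (cs_adj (a + i) * (a + i))"
    by (simp add: cstar_identity)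
  also have "cs_adj (a + i) * (a + i) = a * a + t\<^sup>2 *\<^sub>R 1"
    by (simp add: adj_add a adji algebra_simps comm i2)
  also have "norm \<dots> \<le> (norm a)\<^sup>2 + t\<^sup>2"
    by (rule norm_triangle_le) (use norm_mult_ineq[of a a] in \<open>simp add: power2_eq_square\<close>)
  also have "\<dots> < (cmod (c + \<i> * complex_of_real t))\<^sup>2"
  proof -
    have "2 * t * Im c = (norm a)\<^sup>2" using c by (simp add: t_def)
    moreover have "0 < (Re c)\<^sup>2 + (Im c)\<^sup>2" using c by (simp add: add_nonneg_pos)
    ultimately show ?thesis
      by (simp add: cmod_power2 power2_sum mult.assoc mult.commute[of t])
  qed
  finally have "norm (a + i) < cmod (c + \<i> * complex_of_real t)"
    by (rule power2_less_imp_less) simp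
  then have "cs_invertible (a + i - cs_scaleC (c + \<i> * complex_of_real t) 1)"
    by (rule invertible_norm_less)
  then show ?thesis by (simp add: i_def scaleC_add_left)
qed

text \<open>The limit \<open>l\<close> satisfies \<open>l = (h + l\<^sup>2) / 2\<close>, that is, \<open>(1 - l)\<^sup>2 = 1 - h\<close>. For \<open>norm h \<le> 1\<close>
  the increments are majorised by those of the scalar iteration with \<open>h = 1\<close>.\<close>

fun sqrt_iter :: "'a \<Rightarrow> nat \<Rightarrow> 'a::real_algebra_1" where
  "sqrt_iter h 0 = 0"
| "sqrt_iter h (Suc k) = (1/2) *\<^sub>R (h + sqrt_iter h k * sqrt_iter h k)"

section \<open>Convergence of the square root iteration\<close>

lemma sqrt_iter_commute:
  assumes "h * x = x * h"
  shows "sqrt_iter h k * x = x * sqrt_iter h k"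
proof (induction k)
  case (Suc k)
  have "sqrt_iter h k * sqrt_iter h k * x = x * (sqrt_iter h k * sqrt_iter h k)"
    using Suc by (metis mult.assoc)
  then show ?case
    by (simp add: distrib_left distrib_right assms)
qed simp

lemma sqrt_iter_real_bounds:
  "0 \<le> sqrt_iter (1::real) k \<and> sqrt_iter (1::real) k \<le> 1 \<and> sqrt_iter (1::real) k \<le> sqrt_iter 1 (Suc k)"
proof (induction k)
  case (Suc k)
  define s where "s = sqrt_iter (1::real) k"
  define s' where "s' = sqrt_iter (1::real) (Suc k)"
  have s': "s' = (1 + s * s) / 2" "0 \<le> s" "s \<le> 1" "s \<le> s'"
    using Suc by (auto simp: s_def s'_def)
  have "s * s \<le> 1" using s' by (simp add: mult_le_one)
  then have 1: "s' \<le> 1" using s' by simp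
  have "s * s \<le> s' * s'" by (intro mult_mono s') (use s' in linarith)
  then have "(1 + s * s) / 2 \<le> (1 + s' * s') / 2" by simp
  then have "s' \<le> (1 + s' * s') / 2" by (simp only: s'(1))
  also have "\<dots> = sqrt_iter 1 (Suc (Suc k))"
    by (simp only: sqrt_iter.simps(2)[of 1 "Suc k"] s'_def) simp
  finally show ?case using 1 s'(2,4) unfolding s'_def by (meson order_trans)
qed simp

text \<open>Two further properties of the limit are recorded: closeness to \<open>1\<close> later
  makes the root itself positive, and the commutation clause makes roots of commuting elements
  commute.\<close>

lemma sqrt_one_minus_ex:
  fixes h :: "'a::cstar_algebra"
  assumes h: "cs_adj h = h" "norm h \<le> 1"
  shows "\<exists>b. cs_adj b = b \<and> b * b = 1 - h \<and> norm (1 - b) \<le> 1 \<and>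
    (\<forall>x. h * x = x * h \<longrightarrow> b * x = x * b)"
proof -
  define a where "a = sqrt_iter h"
  define s where "s = sqrt_iter (1::real)"
  have comm: "a k * a j = a j * a k" for j k
    unfolding a_def by (intro sqrt_iter_commute sqrt_iter_commute[symmetric]) auto
  have sa: "cs_adj (a k) = a k" for k
    by (induction k) (simp_all add: a_def adj_add adj_mult h)
  have s0: "0 \<le> s k" "s k \<le> 1" for k
    using sqrt_iter_real_bounds[of k] by (auto simp: s_def)
  have bound: "norm (a k) \<le> s k" for k
  proof (induction k)
    case (Suc k)
    have "norm (a k * a k) \<le> s k * s k"
      using Suc s0[of k] by (intro order_trans[OF norm_mult_ineq] mult_mono) auto
    then show ?case
      using norm_triangle_ineq[of h "a k * a k"] h by (simp add: a_def s_def)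
  qed (simp add: a_def s_def)
  have incr: "norm (a (Suc k) - a k) \<le> s (Suc k) - s k" for k
  proof (induction k)
    case 0
    show ?case using h by (simp add: a_def s_def)
  next
    case (Suc k)
    have "a (Suc (Suc k)) - a (Suc k) = (1/2) *\<^sub>R (a (Suc k) * a (Suc k) - a k * a k)"
      by (simp add: a_def flip: scaleR_diff_right)
    also have "a (Suc k) * a (Suc k) - a k * a k = (a (Suc k) - a k) * (a (Suc k) + a k)"
      using comm[of "Suc k" k] by (simp add: algebra_simps)
    finally have "norm (a (Suc (Suc k)) - a (Suc k)) = (1/2) * norm ((a (Suc k) - a k) * (a (Suc k) + a k))"
      by simp
    also have "\<dots> \<le> (1/2) * ((s (Suc k) - s k) * (s (Suc k) + s k))"
      using Suc bound[of k] bound[of "Suc k"] s0[of k] s0[of "Suc k"] sqrt_iter_real_bounds[of k, folded s_def]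
      by (intro mult_left_mono order_trans[OF norm_mult_ineq] mult_mono
          order_trans[OF norm_triangle_ineq] add_mono) (auto intro: order_trans[OF norm_ge_zero])
    also have "\<dots> = s (Suc (Suc k)) - s (Suc k)"
      by (simp add: s_def field_simps)
    finally show ?case .
  qed
  have "convergent s"
  proof (rule Bseq_mono_convergent)
    show "Bseq s" using s0 by (intro BseqI'[of _ 1]) simp
    have "incseq s" using sqrt_iter_real_bounds unfolding s_def incseq_Suc_iff by blast
    then show "\<forall>m n. m \<le> n \<longrightarrow> s m \<le> s n" by (simp add: incseq_def)
  qed
  then have "summable (\<lambda>k. s (Suc k) - s k)"
    using telescope_summable unfolding convergent_def by blast
  then have "summable (\<lambda>k. a (Suc k) - a k)"
    by (rule summable_comparison_test') (use incr in auto)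
  then have "(\<lambda>n. \<Sum>k<n. a (Suc k) - a k) \<longlonglongrightarrow> (\<Sum>k. a (Suc k) - a k)"
    by (rule summable_LIMSEQ)
  moreover have "a 0 = 0" by (simp add: a_def)
  ultimately obtain l where l: "a \<longlonglongrightarrow> l"
    by (auto simp: sum_lessThan_telescope)
  have adjl: "cs_adj l = l"
  proof (rule LIMSEQ_unique[OF _ l])
    have "(\<lambda>n. norm (a n - l)) \<longlonglongrightarrow> 0"
      using l by (simp add: LIM_zero_iff tendsto_norm_zero_iff)
    \<comment> \<open>The involution is isometric and fixes \<open>a n\<close>, so \<open>a\<close>
      converges to \<open>cs_adj l\<close> as well.\<close>
    moreover have "norm (a n - l) = norm (a n - cs_adj l)" for n
      by (metis adj_diff norm_adj sa)
    ultimately show "a \<longlonglongrightarrow> cs_adj l"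
      by (simp add: tendsto_norm_zero_iff LIM_zero_iff)
  qed
  have "(\<lambda>n. a (Suc n)) \<longlonglongrightarrow> (1/2) *\<^sub>R (h + l * l)"
    unfolding a_def sqrt_iter.simps by (intro tendsto_intros l[unfolded a_def])
  then have "l = (1/2) *\<^sub>R (h + l * l)"
    using LIMSEQ_Suc[OF l] LIMSEQ_unique by blast
  then have "2 *\<^sub>R l = h + l * l"
    by (metis scaleR_half_double scaleR_2 scaleR_add_right)
  then have sq: "(1 - l) * (1 - l) = 1 - h"
    by (simp add: algebra_simps scaleR_2)
  have nl: "norm (1 - (1 - l)) \<le> 1"
  proof -
    have "norm (a n) \<le> 1" for n
      using bound s0(2) by (rule order_trans)
    then have "norm l \<le> 1"
      by (intro LIMSEQ_le_const2[OF tendsto_norm[OF l]]) auto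
    then show ?thesis by simp
  qed
  have commx: "(1 - l) * x = x * (1 - l)" if "h * x = x * h" for x
  proof -
    have "(\<lambda>n. a n * x) \<longlonglongrightarrow> x * l"
      using sqrt_iter_commute[OF that] l by (simp add: a_def tendsto_mult_left)
    moreover have "(\<lambda>n. a n * x) \<longlonglongrightarrow> l * x"
      using l by (simp add: tendsto_mult_right)
    ultimately have "l * x = x * l" using LIMSEQ_unique by blast
    then show ?thesis by (simp add: left_diff_distrib right_diff_distrib)
  qed
  have "cs_adj (1 - l) = 1 - l" by (simp add: adj_diff adjl)
  then show ?thesis using sq nl commx by blast
qed

text \<open>Both \<open>p + \<i>q\<close> and \<open>p - \<i>q\<close> are multiples of unitaries.\<close>

lemma norm_le_of_sum_squares:
  fixes p q :: "'a::cstar_algebra"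
  assumes sa: "cs_adj p = p" "cs_adj q = q" and comm: "p * q = q * p"
    and sum: "p * p + q * q = r *\<^sub>R 1"
  shows "(norm p)\<^sup>2 \<le> \<bar>r\<bar>"
proof -
  let ?j = "cs_scaleC \<i> q"
  have adjj: "cs_adj ?j = - ?j"
    by (simp add: adj_scaleC sa)
  have jj: "?j * ?j = - (q * q)"
    by (simp add: scaleC_mult_left scaleC_mult_right scaleC_scaleC scaleC_one)
  have pj: "p * ?j = ?j * p"
    by (simp add: scaleC_mult_left scaleC_mult_right comm)
  have 1: "(norm (p + ?j))\<^sup>2 = \<bar>r\<bar>"
    using cstar_identity[of "p + ?j"] sum by (simp add: adj_add adjj sa algebra_simps jj pj)
  have 2: "(norm (p - ?j))\<^sup>2 = \<bar>r\<bar>"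
    using cstar_identity[of "p - ?j"] sum by (simp add: adj_diff adjj sa algebra_simps jj pj)
  have "2 * norm p = norm ((p + ?j) + (p - ?j))"
    by (simp flip: scaleR_2)
  also have "\<dots> \<le> norm (p + ?j) + norm (p - ?j)"
    by (rule norm_triangle_ineq)
  also have "norm (p - ?j) = norm (p + ?j)"
    using 1 2 by (metis norm_ge_zero power2_eq_imp_eq)
  finally have "norm p \<le> norm (p + ?j)" by simp
  then show ?thesis using 1 by (metis norm_ge_zero power_mono)
qed

subsection \<open>Squares of self-adjoint elements\<close>

text \<open>The working form of positivity, shown to agree with \<open>cs_positive\<close> in
  \<open>cs_positive_iff_sq_pos\<close>. The witness may be any self-adjoint root; a positive one is
  recovered in \<open>sq_pos_sqrt_ex\<close>.\<close>

definition sq_pos :: "'a::cstar_algebra \<Rightarrow> bool" where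
  "sq_pos a \<longleftrightarrow> (\<exists>b. cs_adj b = b \<and> b * b = a)"

lemma sq_pos_sa: "sq_pos a \<Longrightarrow> cs_adj a = a"
  by (auto simp: sq_pos_def adj_mult)

lemma sq_pos_0 [simp]: "sq_pos 0"
  unfolding sq_pos_def by (intro exI[of _ 0]) simp

lemma sq_pos_1 [simp]: "sq_pos 1"
  unfolding sq_pos_def by (intro exI[of _ 1]) simp

lemma sq_pos_scaleR: "sq_pos a \<Longrightarrow> 0 \<le> r \<Longrightarrow> sq_pos (r *\<^sub>R a)"
  unfolding sq_pos_def by (elim exE, rule_tac x = "sqrt r *\<^sub>R b" in exI) auto

lemma sqrt_diff_ex:
  fixes h :: "'a::cstar_algebra"
  assumes h: "cs_adj h = h" "norm h \<le> M"
  shows "\<exists>b. cs_adj b = b \<and> b * b = M *\<^sub>R 1 - h \<and> norm (sqrt M *\<^sub>R 1 - b) \<le> sqrt M \<and>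
    (\<forall>x. h * x = x * h \<longrightarrow> b * x = x * b)"
proof (cases "M = 0")
  case True
  then show ?thesis using h by (intro exI[of _ 0]) simp
next
  case False
  then have M: "M > 0" using h norm_ge_zero[of h] by linarith
  have h': "cs_adj ((1/M) *\<^sub>R h) = (1/M) *\<^sub>R h" "norm ((1/M) *\<^sub>R h) \<le> 1"
    using h M by simp_all
  obtain b where b: "cs_adj b = b" "b * b = 1 - (1/M) *\<^sub>R h" "norm (1 - b) \<le> 1"
    "\<forall>x. ((1/M) *\<^sub>R h) * x = x * ((1/M) *\<^sub>R h) \<longrightarrow> b * x = x * b"
    using sqrt_one_minus_ex[OF h'] by blast
  show ?thesis
  proof (intro exI[of _ "sqrt M *\<^sub>R b"] conjI allI impI)
    show "(sqrt M *\<^sub>R b) * (sqrt M *\<^sub>R b) = M *\<^sub>R 1 - h"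
      using M b(2) by (simp add: scaleR_diff_right)
    have "norm (sqrt M *\<^sub>R (1 - b)) \<le> sqrt M"
      using M b(3) by simp
    then show "norm (sqrt M *\<^sub>R 1 - sqrt M *\<^sub>R b) \<le> sqrt M"
      by (simp add: scaleR_diff_right)
    show "cs_adj (sqrt M *\<^sub>R b) = sqrt M *\<^sub>R b"
      using b(1) by simp
    fix x assume "h * x = x * h"
    then have "b * x = x * b" by (intro b(4)[rule_format]) simp
    then show "sqrt M *\<^sub>R b * x = x * sqrt M *\<^sub>R b" by simp
  qed
qed

text \<open>Take the root of \<open>M - h\<close> for \<open>h = M - a\<close>. Together with the
  converse \<open>sq_pos_norm_diff\<close> this turns positivity into a norm inequality.\<close>

lemma sq_posI_norm:
  assumes "cs_adj a = a" "norm (M *\<^sub>R 1 - a) \<le> M"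
  shows "sq_pos a"
proof -
  have "cs_adj (M *\<^sub>R 1 - a) = M *\<^sub>R 1 - a" using assms(1) by (simp add: adj_diff)
  then obtain b where "cs_adj b = b" "b * b = M *\<^sub>R 1 - (M *\<^sub>R 1 - a)"
    using sqrt_diff_ex[OF _ assms(2)] by blast
  then show ?thesis by (auto simp: sq_pos_def)
qed

text \<open>A root \<open>c\<close> of \<open>M - a\<close> can be chosen to commute with a root
  \<open>b\<close> of \<open>a\<close>, and their squares add up to \<open>M\<close>.\<close>

lemma sq_pos_norm_diff:
  fixes a :: "'a::cstar_algebra"
  assumes "sq_pos a" "norm a \<le> M"
  shows "norm (M *\<^sub>R 1 - a) \<le> M"
proof -
  obtain b where b: "cs_adj b = b" "b * b = a" using assms(1) by (auto simp: sq_pos_def)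
  obtain c where c: "cs_adj c = c" "c * c = M *\<^sub>R 1 - a" "\<forall>x. a * x = x * a \<longrightarrow> c * x = x * c"
    using sqrt_diff_ex[OF sq_pos_sa[OF assms(1)] assms(2)] by blast
  have "c * b = b * c" using b by (intro c(3)[rule_format]) (simp add: mult.assoc flip: b(2))
  then have "(norm c)\<^sup>2 \<le> \<bar>M\<bar>"
    using b c(1,2) by (intro norm_le_of_sum_squares[of c b]) simp_all
  moreover have "0 \<le> M" using assms(2) norm_ge_zero order_trans by blast
  ultimately show ?thesis using norm_square_sa[OF c(1)] c(2) by simp
qed

lemma sq_pos_add:
  fixes a b :: "'a::cstar_algebra"
  assumes "sq_pos a" "sq_pos b"
  shows "sq_pos (a + b)"
proof (rule sq_posI_norm)
  show "cs_adj (a + b) = a + b" using assms by (simp add: adj_add sq_pos_sa)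
  have "(norm a + norm b) *\<^sub>R 1 - (a + b) = (norm a *\<^sub>R 1 - a) + (norm b *\<^sub>R 1 - b)"
    by (simp add: algebra_simps)
  then show "norm ((norm a + norm b) *\<^sub>R 1 - (a + b)) \<le> norm a + norm b"
    using norm_triangle_mono[OF sq_pos_norm_diff[OF assms(1) order_refl]
        sq_pos_norm_diff[OF assms(2) order_refl]] by (simp only:)
qed

lemma sq_pos_norm_bound:
  fixes a :: "'a::cstar_algebra"
  assumes "cs_adj a = a" "norm a \<le> M"
  shows "sq_pos (M *\<^sub>R 1 - a)" "sq_pos (M *\<^sub>R 1 + a)"
  using assms by (auto intro!: sq_posI_norm[of _ M] simp: adj_diff adj_add)

lemma sq_pos_closed:
  fixes a c :: "'a::cstar_algebra"
  assumes "\<And>e. e > 0 \<Longrightarrow> sq_pos (a + e *\<^sub>R c)"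
  shows "sq_pos a"
proof -
  have lim: "(\<lambda>n. a + inverse (real (Suc n)) *\<^sub>R c) \<longlonglongrightarrow> a + 0 *\<^sub>R c"
    by (intro tendsto_intros LIMSEQ_inverse_real_of_nat)
  have pos: "sq_pos (a + inverse (real (Suc n)) *\<^sub>R c)" for n
    by (intro assms) simp
  \<comment> \<open>Nothing is assumed about \<open>c\<close>; comparing \<open>e = 1\<close> with
    \<open>e = 2\<close> shows first \<open>c\<close> and then \<open>a\<close> to be
    self-adjoint.\<close>
  have "cs_adj (a + c) = a + c" "cs_adj (a + 2 *\<^sub>R c) = a + 2 *\<^sub>R c"
    using assms[of 1] assms[of 2] sq_pos_sa by force+
  then have "cs_adj a + cs_adj c = a + c" "cs_adj a + (cs_adj c + cs_adj c) = a + (c + c)"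
    by (simp_all add: adj_add scaleR_2)
  then have sa: "cs_adj a = a"
    by (metis add.assoc add_left_cancel add_right_cancel)
  show ?thesis
  proof (rule sq_posI_norm[OF sa])
    let ?M = "norm a + norm c"
    have "norm (?M *\<^sub>R 1 - (a + inverse (real (Suc n)) *\<^sub>R c)) \<le> ?M" for n
    proof (rule sq_pos_norm_diff[OF pos])
      have "norm (inverse (real (Suc n)) *\<^sub>R c) \<le> 1 * norm c"
        unfolding norm_scaleR by (intro mult_right_mono) (auto simp: field_simps)
      then show "norm (a + inverse (real (Suc n)) *\<^sub>R c) \<le> ?M"
        using norm_triangle_ineq[of a "inverse (real (Suc n)) *\<^sub>R c"] by linarith
    qed
    moreover have "(\<lambda>n. norm (?M *\<^sub>R 1 - (a + inverse (real (Suc n)) *\<^sub>R c)))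
        \<longlonglongrightarrow> norm (?M *\<^sub>R 1 - (a + 0 *\<^sub>R c))"
      by (intro tendsto_intros lim)
    ultimately have "norm (?M *\<^sub>R 1 - (a + 0 *\<^sub>R c)) \<le> ?M"
      by (intro LIMSEQ_le_const2) auto
    then show "norm (?M *\<^sub>R 1 - a) \<le> ?M" by simp
  qed
qed

text \<open>\<open>- (a + t)\<close> is \<open>norm a - a\<close> minus the scalar
  \<open>norm a + t\<close>, which exceeds the norm of \<open>norm a - a\<close>.\<close>

lemma sq_pos_invertible:
  fixes a :: "'a::cstar_algebra"
  assumes "sq_pos a" "t > 0"
  shows "cs_invertible (a + t *\<^sub>R 1)"
proof -
  have "norm (norm a *\<^sub>R 1 - a) < cmod (complex_of_real (norm a + t))"
    using sq_pos_norm_diff[OF assms(1) order_refl] assms(2) unfolding norm_of_real by simp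
  then have "cs_invertible (norm a *\<^sub>R 1 - a - cs_scaleC (complex_of_real (norm a + t)) 1)"
    by (rule invertible_norm_less)
  then have "cs_invertible (cs_scaleC (-1) (norm a *\<^sub>R 1 - a - cs_scaleC (complex_of_real (norm a + t)) 1))"
    by (rule invertible_scaleC) simp
  then show ?thesis
    by (simp only: scaleC_of_real) (simp add: scaleC_one scaleR_left_distrib add.commute)
qed

lemma sq_pos_sqrt_ex:
  fixes a :: "'a::cstar_algebra"
  assumes "sq_pos a"
  shows "\<exists>b. sq_pos b \<and> b * b = a \<and> (\<forall>x. a * x = x * a \<longrightarrow> b * x = x * b)"
proof -
  have sa: "cs_adj (norm a *\<^sub>R 1 - a) = norm a *\<^sub>R 1 - a"
    using assms by (simp add: adj_diff sq_pos_sa)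
  have n: "norm (norm a *\<^sub>R 1 - a) \<le> norm a"
    using assms by (intro sq_pos_norm_diff) auto
  obtain b where b: "cs_adj b = b" "b * b = norm a *\<^sub>R 1 - (norm a *\<^sub>R 1 - a)"
      "norm (sqrt (norm a) *\<^sub>R 1 - b) \<le> sqrt (norm a)"
      "\<forall>x. (norm a *\<^sub>R 1 - a) * x = x * (norm a *\<^sub>R 1 - a) \<longrightarrow> b * x = x * b"
    using sqrt_diff_ex[OF sa n] by blast
  show ?thesis
  proof (intro exI[of _ b] conjI allI impI)
    show "sq_pos b" using b(1,3) by (rule sq_posI_norm)
    show "b * b = a" using b(2) by simp
    fix x assume "a * x = x * a"
    then show "b * x = x * b"
      by (intro b(4)[rule_format]) (simp add: left_diff_distrib right_diff_distrib)
  qed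
qed

subsection \<open>Positive elements\<close>

text \<open>If \<open>P 0\<close> failed, the infimum of all \<open>t\<close> with
  \<open>P t\<close> would be attained by closedness, hence be positive, and openness would lower
  it. Stated for a predicate because it serves both single elements and matrix forms.\<close>

lemma upward_closed_open_imp_zero:
  fixes P :: "real \<Rightarrow> bool"
  assumes up: "\<And>s t. P s \<Longrightarrow> s \<le> t \<Longrightarrow> P t" and ex: "P T"
    and closed: "\<And>t. (\<And>e. e > 0 \<Longrightarrow> P (t + e)) \<Longrightarrow> P t"
    and opn: "\<And>t. t > 0 \<Longrightarrow> P t \<Longrightarrow> \<exists>e>0. P (t - e)"
  shows "P 0"
proof (rule ccontr)
  assume n: "\<not> P 0"
  let ?t = "Inf {t. P t}"
  have lb: "0 \<le> t" if "P t" for t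
    using up[OF that, of 0] n by force
  then have bdd: "bdd_below {t. P t}" by (auto intro!: bdd_belowI[of _ 0])
  have "P (?t + e)" if "e > 0" for e
    using cInf_lessD[of "{t. P t}" "?t + e"] ex that up by fastforce
  then have t: "P ?t" by (rule closed)
  then have "?t > 0" using lb n by (metis order_le_less)
  then obtain e where "e > 0" "P (?t - e)" using opn t by blast
  then show False using cInf_lower[OF _ bdd, of "?t - e"] by simp
qed

lemma invertible_left_right:
  fixes x :: "'a::cstar_algebra"
  assumes "l * x = 1" "x * r = 1"
  shows "cs_invertible x"
proof -
  have "l = r" using assms by (metis mult.assoc mult.left_neutral mult.right_neutral)
  then show ?thesis using assms unfolding cs_invertible_def by blast
qed

lemma invertible_commuting_factor:
  fixes x y :: "'a::cstar_algebra"
  assumes "cs_invertible (x * y)" "x * y = y * x"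
  shows "cs_invertible x"
proof -
  obtain z where z: "x * y * z = 1" "z * (x * y) = 1"
    using assms(1) unfolding cs_invertible_def by blast
  show ?thesis
  proof (rule invertible_left_right)
    show "(z * y) * x = 1" using z(2) assms(2) by (simp add: mult.assoc)
    show "x * (y * z) = 1" using z(1) by (simp add: mult.assoc)
  qed
qed

text \<open>With \<open>d\<close> the inverse of \<open>b\<close> and \<open>K \<ge> norm d\<close>,
  the element \<open>K *\<^sub>R b - 1 = b * (K *\<^sub>R 1 - d)\<close> is a product of commuting
  positive elements, hence the square of the product of commuting roots. This gives
  \<open>e = 1 / K\<close>.\<close>

lemma sq_pos_invertible_diff:
  fixes b :: "'a::cstar_algebra"
  assumes "sq_pos b" "cs_invertible b"
  shows "\<exists>e>0. sq_pos (b - e *\<^sub>R 1)"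
proof -
  obtain p where p: "cs_adj p = p" "p * p = b" using assms(1) by (auto simp: sq_pos_def)
  obtain d where d: "b * d = 1" "d * b = 1" using assms(2) by (auto simp: cs_invertible_def)
  have pb: "p * b = b * p" by (simp add: mult.assoc flip: p(2))
  have "cs_adj d * b = 1"
    using arg_cong[OF d(1), of cs_adj] sq_pos_sa[OF assms(1)] by (simp add: adj_mult)
  then have adjd: "cs_adj d = d"
    by (metis d(1) mult.assoc mult.left_neutral mult.right_neutral)
  have dp: "d * p = p * d"
    by (metis pb d mult.assoc mult.left_neutral mult.right_neutral)
  define K where "K = norm d + 1"
  have K: "norm d \<le> K" "K > 0" by (auto simp: K_def add_nonneg_pos)
  obtain r where r: "cs_adj r = r" "r * r = K *\<^sub>R 1 - d" "\<forall>x. d * x = x * d \<longrightarrow> r * x = x * r"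
    using sqrt_diff_ex[OF adjd K(1)] by blast
  have rp: "r * p = p * r" using r(3) dp by blast
  have "(p * r) * (p * r) = (p * p) * (r * r)"
    by (metis rp mult.assoc)
  also have "\<dots> = K *\<^sub>R b - 1"
    by (simp add: p(2) r(2) right_diff_distrib d)
  finally have "sq_pos (K *\<^sub>R b - 1)"
    unfolding sq_pos_def by (intro exI[of _ "p * r"]) (simp add: adj_mult p(1) r(1) rp)
  then have "sq_pos ((1/K) *\<^sub>R (K *\<^sub>R b - 1))"
    using K(2) by (intro sq_pos_scaleR) auto
  then have "sq_pos (b - (1/K) *\<^sub>R 1)"
    using K(2) by (simp add: scaleR_diff_right)
  then show ?thesis using K(2) by (intro exI[of _ "1/K"]) simp
qed

text \<open>Continuity method: the set of \<open>t \<ge> 0\<close> with \<open>sq_pos (a + t)\<close> contains all large \<open>t\<close>, is closed,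
  and is open at every \<open>t > 0\<close> because \<open>a + t\<close> is invertible. This avoids the spectral radius formula.\<close>

lemma sq_posI_invertible:
  fixes a :: "'a::cstar_algebra"
  assumes sa: "cs_adj a = a" and inv: "\<And>t. t > 0 \<Longrightarrow> cs_invertible (a + t *\<^sub>R 1)"
  shows "sq_pos a"
proof -
  have "sq_pos (a + 0 *\<^sub>R 1)"
  proof (rule upward_closed_open_imp_zero[of "\<lambda>t. sq_pos (a + t *\<^sub>R 1)" "norm a"])
    show "sq_pos (a + norm a *\<^sub>R 1)"
      using sq_pos_norm_bound(2)[OF sa order_refl] by (simp add: add.commute)
  next
    fix s t :: real assume *: "sq_pos (a + s *\<^sub>R 1)" "s \<le> t"
    have "a + t *\<^sub>R 1 = (a + s *\<^sub>R 1) + (t - s) *\<^sub>R 1" by (simp add: scaleR_left_diff_distrib)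
    also have "sq_pos \<dots>" by (rule sq_pos_add[OF *(1)]) (use *(2) in \<open>auto intro: sq_pos_scaleR\<close>)
    finally show "sq_pos (a + t *\<^sub>R 1)" .
  next
    fix t :: real assume *: "\<And>e. e > 0 \<Longrightarrow> sq_pos (a + (t + e) *\<^sub>R 1)"
    show "sq_pos (a + t *\<^sub>R 1)"
      by (rule sq_pos_closed[of _ 1]) (use * in \<open>simp add: scaleR_left_distrib add.assoc\<close>)
  next
    fix t :: real assume "t > 0" "sq_pos (a + t *\<^sub>R 1)"
    then obtain e where "e > 0" "sq_pos (a + t *\<^sub>R 1 - e *\<^sub>R 1)"
      using sq_pos_invertible_diff inv by blast
    then show "\<exists>e>0. sq_pos (a + (t - e) *\<^sub>R 1)"
      by (intro exI[of _ e]) (simp add: scaleR_left_diff_distrib add_diff_eq)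
  qed
  then show ?thesis by simp
qed

text \<open>One direction needs only invertibility at the negative reals. In the other,
  self-adjointness excludes nonreal spectrum and \<open>sq_pos_invertible\<close> excludes negative
  spectrum.\<close>

lemma cs_positive_iff_sq_pos: "cs_positive a \<longleftrightarrow> sq_pos (a::'a::cstar_algebra)"
proof
  assume a: "cs_positive a"
  show "sq_pos a"
  proof (rule sq_posI_invertible)
    show "cs_adj a = a" using a by (simp add: cs_positive_def)
    fix t :: real assume "t > 0"
    then have "complex_of_real (- t) \<notin> cs_spectrum a"
      using a by (force simp: cs_positive_def)
    then show "cs_invertible (a + t *\<^sub>R 1)"
      unfolding cs_spectrum_def mem_Collect_eq scaleC_of_real by simp
  qed
next
  assume a: "sq_pos a"
  have "Im c = 0 \<and> Re c \<ge> 0" if c: "c \<in> cs_spectrum a" for c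
  proof -
    have "Im c = 0"
      using c sa_spectrum_real[OF sq_pos_sa[OF a], of c] unfolding cs_spectrum_def by blast
    then have "c = complex_of_real (Re c)" by (simp add: complex_eq_iff)
    then obtain r where r: "c = complex_of_real r" by blast
    have "\<not> r < 0"
    proof
      assume "r < 0"
      then have "cs_invertible (a + (- r) *\<^sub>R 1)"
        by (intro sq_pos_invertible a) simp
      moreover have "\<not> cs_invertible (a - r *\<^sub>R 1)"
        using c unfolding cs_spectrum_def mem_Collect_eq r scaleC_of_real .
      ultimately show False by simp
    qed
    then show ?thesis by (simp add: r)
  qed
  then show "cs_positive a" using sq_pos_sa[OF a] by (simp add: cs_positive_def)
qed

text \<open>If \<open>s\<close> inverts \<open>t - x y\<close>, then \<open>(1 + y s x) / t\<close>
  inverts \<open>t - y x\<close>.\<close>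

lemma invertible_swap:
  fixes x y :: "'a::cstar_algebra"
  assumes "cs_invertible (t *\<^sub>R 1 - x * y)" "t \<noteq> 0"
  shows "cs_invertible (t *\<^sub>R 1 - y * x)"
proof -
  obtain s where s: "(t *\<^sub>R 1 - x * y) * s = 1" "s * (t *\<^sub>R 1 - x * y) = 1"
    using assms(1) unfolding cs_invertible_def by blast
  have "t *\<^sub>R s - x * y * s = 1" "t *\<^sub>R s - s * (x * y) = 1"
    using s by (simp_all add: left_diff_distrib right_diff_distrib)
  then have 1: "x * y * s = t *\<^sub>R s - 1" and 2: "s * (x * y) = t *\<^sub>R s - 1"
    by (metis add_diff_cancel_left' diff_add_cancel)+
  have A1: "y * x * (y * s * x) = t *\<^sub>R (y * s * x) - y * x"
  proof -
    have "y * x * (y * s * x) = y * (x * y * s) * x" by (simp add: mult.assoc)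
    then show ?thesis unfolding 1 by (simp add: right_diff_distrib left_diff_distrib)
  qed
  have A2: "(y * s * x) * (y * x) = t *\<^sub>R (y * s * x) - y * x"
  proof -
    have "(y * s * x) * (y * x) = y * (s * (x * y)) * x" by (simp add: mult.assoc)
    then show ?thesis unfolding 2 by (simp add: right_diff_distrib left_diff_distrib)
  qed
  have "(t *\<^sub>R 1 - y * x) * (1 + y * s * x) = t *\<^sub>R 1"
    by (simp add: left_diff_distrib distrib_left A1 scaleR_right_distrib)
  moreover have "(1 + y * s * x) * (t *\<^sub>R 1 - y * x) = t *\<^sub>R 1"
    by (simp add: right_diff_distrib distrib_right A2 scaleR_right_distrib)
  ultimately have "(t *\<^sub>R 1 - y * x) * ((1/t) *\<^sub>R (1 + y * s * x)) = 1"
    "((1/t) *\<^sub>R (1 + y * s * x)) * (t *\<^sub>R 1 - y * x) = 1"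
    using assms(2) unfolding mult_scaleR_left mult_scaleR_right by simp_all
  then show ?thesis unfolding cs_invertible_def by blast
qed

lemma sq_pos_uminus_swap:
  fixes x :: "'a::cstar_algebra"
  assumes "sq_pos (- (cs_adj x * x))"
  shows "sq_pos (- (x * cs_adj x))"
proof (rule sq_posI_invertible)
  show "cs_adj (- (x * cs_adj x)) = - (x * cs_adj x)" by (simp add: adj_mult adj_adj)
  fix t :: real assume t: "t > 0"
  have "cs_invertible (t *\<^sub>R 1 - cs_adj x * x)"
    using sq_pos_invertible[OF assms t] by (simp add: algebra_simps)
  then have "cs_invertible (t *\<^sub>R 1 - x * cs_adj x)"
    by (rule invertible_swap) (use t in simp)
  then show "cs_invertible (- (x * cs_adj x) + t *\<^sub>R 1)" by (simp add: algebra_simps)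
qed

text \<open>Commuting roots of \<open>a\<close> and \<open>K - a\<close> have squares with sum
  \<open>K\<close>, so \<open>norm_le_of_sum_squares\<close> bounds the root of
  \<open>a\<close>.\<close>

lemma norm_le_of_order_unit:
  fixes a :: "'a::cstar_algebra"
  assumes "sq_pos a" "sq_pos (K *\<^sub>R 1 - a)" "K \<ge> 0"
  shows "norm a \<le> K"
proof -
  obtain p where p: "cs_adj p = p" "p * p = a" using assms(1) by (auto simp: sq_pos_def)
  obtain q where q: "sq_pos q" "q * q = K *\<^sub>R 1 - a"
    "\<forall>x. (K *\<^sub>R 1 - a) * x = x * (K *\<^sub>R 1 - a) \<longrightarrow> q * x = x * q"
    using sq_pos_sqrt_ex[OF assms(2)] by blast
  have "a * p = p * a" by (simp add: mult.assoc flip: p(2))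
  then have "q * p = p * q"
    by (intro q(3)[rule_format]) (simp add: left_diff_distrib right_diff_distrib)
  then have "(norm p)\<^sup>2 \<le> \<bar>K\<bar>"
    using p q(1,2) by (intro norm_le_of_sum_squares[of p q]) (auto simp: sq_pos_sa)
  then show ?thesis using norm_square_sa[OF p(1)] p(2) assms(3) by simp
qed

lemma sq_pos_antisym:
  fixes a :: "'a::cstar_algebra"
  assumes "sq_pos a" "sq_pos (- a)"
  shows "a = 0"
proof -
  have "norm a \<le> 0 + e" if "e > 0" for e
    using norm_le_of_order_unit[of a e] sq_pos_add[OF assms(2) sq_pos_scaleR[OF sq_pos_1, of e]]
      assms that by simp
  then have "norm a \<le> 0" by (rule field_le_epsilon)
  then show ?thesis by simp
qed

text \<open>Here \<open>s\<close> plays the role of the absolute value of \<open>a\<close>; for \<open>t > 0\<close>,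
  \<open>(s + a + t) (s - a + t) = 2 t s + t\<^sup>2\<close> is invertible.\<close>

lemma sq_pos_abs_add:
  fixes a s :: "'a::cstar_algebra"
  assumes sa: "cs_adj a = a" and s: "sq_pos s" "s * s = a * a" "s * a = a * s"
  shows "sq_pos (s + a)"
proof (rule sq_posI_invertible)
  show "cs_adj (s + a) = s + a" using sa s by (simp add: adj_add sq_pos_sa)
  fix t :: real assume t: "t > 0"
  let ?x = "s + a + t *\<^sub>R 1" and ?y = "s - a + t *\<^sub>R 1"
  have xy: "?x * ?y = t *\<^sub>R (s + s) + (t * t) *\<^sub>R 1" "?y * ?x = t *\<^sub>R (s + s) + (t * t) *\<^sub>R 1"
    by (simp_all add: algebra_simps s)
  have "cs_invertible (?x * ?y)"
    unfolding xy using s t by (intro sq_pos_invertible sq_pos_scaleR sq_pos_add) auto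
  then show "cs_invertible ?x" by (rule invertible_commuting_factor) (simp only: xy)
qed

lemma sa_decomposition:
  fixes a :: "'a::cstar_algebra"
  assumes sa: "cs_adj a = a"
  obtains p m where "sq_pos p" "sq_pos m" "a = p - m" "p * m = 0"
proof -
  have "sq_pos (a * a)" using sa by (auto simp: sq_pos_def)
  then obtain s where s: "sq_pos s" "s * s = a * a" "\<forall>x. a * a * x = x * (a * a) \<longrightarrow> s * x = x * s"
    using sq_pos_sqrt_ex by blast
  have comm: "s * a = a * s" using s(3) by (simp add: mult.assoc)
  \<comment> \<open>Positive and negative part of \<open>a\<close>. As \<open>s\<close> commutes
    with \<open>a\<close>, their product is a quarter of \<open>s * s - a * a = 0\<close>.\<close>
  let ?p = "(1/2) *\<^sub>R (s + a)" and ?m = "(1/2) *\<^sub>R (s + - a)"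
  show ?thesis
  proof (rule that)
    show "sq_pos ?p" using sa s(1,2) comm by (intro sq_pos_scaleR sq_pos_abs_add) auto
    show "sq_pos ?m" using sa s(1,2) comm by (intro sq_pos_scaleR sq_pos_abs_add) auto
    show "a = ?p - ?m" by (simp flip: scaleR_diff_right scaleR_2)
    show "?p * ?m = 0" by (simp add: algebra_simps comm s(2))
  qed
qed

text \<open>For \<open>y = x m\<close> with \<open>m\<close> the negative part of \<open>x\<^sup>* x\<close>, \<open>y\<^sup>* y = - m\<^sup>3 \<le> 0\<close>. Then also \<open>y y\<^sup>* \<le> 0\<close>,
  whereas \<open>y\<^sup>* y + y y\<^sup>* \<ge> 0\<close> always; hence \<open>m = 0\<close>.\<close>

lemma sq_pos_adj_mult [simp]: "sq_pos (cs_adj x * (x::'a::cstar_algebra))"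
proof -
  obtain p m where pm: "sq_pos p" "sq_pos m" "cs_adj x * x = p - m" "p * m = 0"
    by (rule sa_decomposition[of "cs_adj x * x"]) (simp add: adj_mult adj_adj)
  obtain r where r: "cs_adj r = r" "r * r = m" using pm(2) by (auto simp: sq_pos_def)
  \<comment> \<open>Since \<open>w * w = m * m * m\<close>, this exhibits the cube of
    \<open>m\<close> as the square of a self-adjoint element.\<close>
  define w where "w = r * r * r"
  have adjw: "cs_adj w = w" by (simp add: w_def adj_mult r(1) mult.assoc)
  define y where "y = x * m"
  have "cs_adj y * y = m * (cs_adj x * x) * m"
    by (simp add: y_def adj_mult sq_pos_sa[OF pm(2)] mult.assoc)
  also have "\<dots> = - (m * m * m)"
    by (simp add: pm(3,4) mult.assoc left_diff_distrib)
  also have "m * m * m = w * w"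
    by (simp add: w_def mult.assoc flip: r(2))
  finally have yy: "cs_adj y * y = - (w * w)" .
  have neg: "sq_pos (- (cs_adj y * y))"
    unfolding yy sq_pos_def using adjw by auto
  \<comment> \<open>Real and imaginary part of \<open>y\<close> up to factors:
    \<open>2 y = u - \<i> v\<close>. Their squares add up to twice
    \<open>y\<^sup>* y + y y\<^sup>*\<close>.\<close>
  define u v where "u = y + cs_adj y" and "v = cs_scaleC \<i> (y - cs_adj y)"
  have uv: "cs_adj u = u" "cs_adj v = v"
    by (simp_all add: u_def v_def adj_add adj_scaleC adj_diff adj_adj add.commute flip: scaleC_minus_right)
  have "v * v = - ((y - cs_adj y) * (y - cs_adj y))"
    by (simp add: v_def scaleC_mult_left scaleC_mult_right scaleC_scaleC scaleC_one)
  then have "u * u + v * v = 2 *\<^sub>R (cs_adj y * y + y * cs_adj y)"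
    by (simp add: u_def algebra_simps scaleR_2)
  moreover have "sq_pos (u * u + v * v)"
    using uv by (intro sq_pos_add) (auto simp: sq_pos_def)
  ultimately have "sq_pos (2 *\<^sub>R (cs_adj y * y + y * cs_adj y))" by simp
  from sq_pos_scaleR[OF this, of "1/2"] have "sq_pos (cs_adj y * y + y * cs_adj y)" by simp
  from sq_pos_add[OF this sq_pos_uminus_swap[OF neg]] have "sq_pos (cs_adj y * y)" by simp
  then have "cs_adj y * y = 0" using neg by (rule sq_pos_antisym)
  then have "w = 0" using yy norm_square_sa[OF adjw] by simp
  then have "m * m = 0" by (simp add: w_def mult.assoc flip: r(2))
  then have "m = 0" using norm_square_sa[OF sq_pos_sa[OF pm(2)]] by simp
  then show ?thesis using pm by simp
qed

lemma sq_pos_conj: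
  assumes "sq_pos a"
  shows "sq_pos (cs_adj x * a * x)"
proof -
  obtain b where "cs_adj b = b" "b * b = a" using assms by (auto simp: sq_pos_def)
  then have "cs_adj x * a * x = cs_adj (b * x) * (b * x)" by (auto simp: adj_mult mult.assoc)
  then show ?thesis by simp
qed

text \<open>A large multiple \<open>M\<close> of the unit satisfies \<open>norm (M - z) < M\<close>.\<close>

lemma invertible_real_part:
  fixes z :: "'a::cstar_algebra"
  assumes "sq_pos (z + cs_adj z - e *\<^sub>R 1)" "e > 0"
  shows "cs_invertible z"
proof -
  \<comment> \<open>With \<open>M * e \<ge> (norm z)\<^sup>2 + 1\<close> the real part of
    \<open>z\<close> absorbs \<open>z\<^sup>* z\<close>, and the squared norm of
    \<open>M - z\<close> is at most \<open>M\<^sup>2 - 1\<close>.\<close>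
  define M where "M = ((norm z)\<^sup>2 + 1) / e + 1"
  have M: "M \<ge> 1" "M * e \<ge> (norm z)\<^sup>2 + 1"
    using assms(2) by (simp_all add: M_def field_simps)
  have eq: "cs_adj (M *\<^sub>R 1 - z) * (M *\<^sub>R 1 - z) = (M\<^sup>2) *\<^sub>R 1 - M *\<^sub>R (z + cs_adj z) + cs_adj z * z"
    by (simp add: adj_diff algebra_simps power2_eq_square)
  have "sq_pos ((norm z)\<^sup>2 *\<^sub>R 1 - cs_adj z * z)"
    by (intro sq_pos_norm_bound) (simp_all add: adj_mult adj_adj cstar_identity)
  then have "sq_pos (M *\<^sub>R (z + cs_adj z - e *\<^sub>R 1) + ((norm z)\<^sup>2 *\<^sub>R 1 - cs_adj z * z)
      + (M * e - (norm z)\<^sup>2 - 1) *\<^sub>R 1)"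
    using M assms by (intro sq_pos_add sq_pos_scaleR) auto
  also have "M *\<^sub>R (z + cs_adj z - e *\<^sub>R 1) + ((norm z)\<^sup>2 *\<^sub>R 1 - cs_adj z * z)
      + (M * e - (norm z)\<^sup>2 - 1) *\<^sub>R 1 = (M\<^sup>2 - 1) *\<^sub>R 1 - cs_adj (M *\<^sub>R 1 - z) * (M *\<^sub>R 1 - z)"
    unfolding eq by (simp add: algebra_simps)
  finally have "norm (cs_adj (M *\<^sub>R 1 - z) * (M *\<^sub>R 1 - z)) \<le> M\<^sup>2 - 1"
    using M(1) by (intro norm_le_of_order_unit) auto
  then have "(norm (M *\<^sub>R 1 - z))\<^sup>2 < M\<^sup>2" by (simp add: cstar_identity)
  then have "norm (M *\<^sub>R 1 - z) < cmod (complex_of_real M)"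
    using M(1) by (simp add: power2_less_imp_less)
  then have "cs_invertible (cs_scaleC (-1) (M *\<^sub>R 1 - z - cs_scaleC (complex_of_real M) 1))"
    by (intro invertible_scaleC invertible_norm_less) auto
  then show ?thesis unfolding scaleC_of_real by (simp add: scaleC_one)
qed

text \<open>For \<open>t > 0\<close> the product \<open>(q + p + t) (q - p + t)\<close> has real part \<open>q\<^sup>2 - p\<^sup>2 + 2 t q + t\<^sup>2 \<ge> t\<^sup>2\<close>.\<close>

lemma sq_pos_sqrt_mono:
  fixes p q :: "'a::cstar_algebra"
  assumes p: "sq_pos p" and q: "sq_pos q" and le: "sq_pos (q * q - p * p)"
  shows "sq_pos (q - p)"
proof (rule sq_posI_invertible)
  note sa = sq_pos_sa[OF p] sq_pos_sa[OF q]
  show "cs_adj (q - p) = q - p" using sa by (simp add: adj_diff)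
  fix t :: real assume t: "t > 0"
  let ?x = "q - p + t *\<^sub>R 1" and ?y = "q + p + t *\<^sub>R 1"
  have adj: "cs_adj ?x = ?x" "cs_adj ?y = ?y" using sa by (simp_all add: adj_diff adj_add)
  have "?y * ?x + cs_adj (?y * ?x) = (q * q - p * p) + (q * q - p * p)
      + (t *\<^sub>R (q + q) + t *\<^sub>R (q + q)) + ((t * t) *\<^sub>R 1 + (t * t) *\<^sub>R 1)"
    unfolding adj_mult adj by (simp add: algebra_simps)
  then have "?y * ?x + cs_adj (?y * ?x) - (t * t + t * t) *\<^sub>R 1 = (q * q - p * p) + (q * q - p * p)
      + (t *\<^sub>R (q + q) + t *\<^sub>R (q + q))"
    by (simp only: scaleR_left_distrib add_diff_cancel_right')
  moreover have "sq_pos \<dots>" using t le q by (intro sq_pos_add sq_pos_scaleR) auto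
  ultimately have "sq_pos (?y * ?x + cs_adj (?y * ?x) - (t * t + t * t) *\<^sub>R 1)"
    by (simp only:)
  then have "cs_invertible (?y * ?x)"
    by (rule invertible_real_part) (use t in simp)
  \<comment> \<open>\<open>?y\<close> need not commute with \<open>?x\<close>, so the product yields
    only a left inverse of \<open>?x\<close>. As \<open>?x\<close> is self-adjoint, taking adjoints
    supplies a right inverse.\<close>
  then obtain l where "l * (?y * ?x) = 1" unfolding cs_invertible_def by blast
  then have l: "(l * ?y) * ?x = 1" unfolding mult.assoc .
  have "?x * cs_adj (l * ?y) = 1"
    using arg_cong[OF l, of cs_adj] unfolding adj_mult[of "l * ?y"] adj(1) adj_one .
  with l show "cs_invertible ?x" by (rule invertible_left_right)
qed

text \<open>Uniqueness, needed for the definite description, is operator monotonicity in both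
  directions followed by antisymmetry.\<close>

lemma cs_sqrt_works:
  fixes a :: "'a::cstar_algebra"
  assumes "cs_positive a"
  shows "cs_positive (cs_sqrt a)" "cs_sqrt a * cs_sqrt a = a"
proof -
  obtain b where b: "sq_pos b" "b * b = a"
    using sq_pos_sqrt_ex[of a] assms unfolding cs_positive_iff_sq_pos by blast
  have "\<exists>!b. cs_positive b \<and> b * b = a"
  proof (rule ex1I[of _ b])
    show "cs_positive b \<and> b * b = a" using b by (simp add: cs_positive_iff_sq_pos)
    fix c assume "cs_positive c \<and> c * c = a"
    then have c: "sq_pos c" "c * c = a" by (simp_all add: cs_positive_iff_sq_pos)
    have "sq_pos (c - b)" "sq_pos (b - c)"
      using sq_pos_sqrt_mono[OF b(1) c(1)] sq_pos_sqrt_mono[OF c(1) b(1)] b(2) c(2) by simp_all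
    then have "c - b = 0" by (intro sq_pos_antisym) simp_all
    then show "c = b" by simp
  qed
  from theI'[OF this] show "cs_positive (cs_sqrt a)" "cs_sqrt a * cs_sqrt a = a"
    unfolding cs_sqrt_def by auto
qed

lemma cs_abs_square: "(cs_abs x)\<^sup>2 = cs_adj x * (x::'a::cstar_algebra)"
  unfolding cs_abs_def power2_eq_square
  by (rule cs_sqrt_works) (simp add: cs_positive_iff_sq_pos)

subsection \<open>Matrices and their quadratic forms\<close>

lemma sq_pos_sum: "(\<And>i. i \<in> S \<Longrightarrow> sq_pos (f i)) \<Longrightarrow> sq_pos (\<Sum>i\<in>S. f i)"
  by (induction S rule: infinite_finite_induct) (auto intro: sq_pos_add)

lemma sq_pos_mult_adj [simp]: "sq_pos (x * cs_adj (x::'a::cstar_algebra))"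
  using sq_pos_adj_mult[of "cs_adj x"] by (simp add: adj_adj)

lemma adj_mat_unit: "cs_adj (mat_unit i j) = (mat_unit j i :: 'a::cstar_algebra)"
  by (simp add: mat_unit_def)

lemma sum_mat_unit_right:
  fixes f :: "nat \<Rightarrow> 'a::cstar_algebra"
  assumes "j < n"
  shows "(\<Sum>k<n. f k * mat_unit k j) = f j"
proof -
  have "(\<Sum>k<n. f k * mat_unit k j) = (\<Sum>k<n. if k = j then f k else 0)"
    by (intro sum.cong) (auto simp: mat_unit_def)
  then show ?thesis using assms by simp
qed

lemma sum_mat_unit_left:
  fixes f :: "nat \<Rightarrow> 'a::cstar_algebra"
  assumes "i < n"
  shows "(\<Sum>k<n. mat_unit i k * f k) = f i"
proof -
  have "(\<Sum>k<n. mat_unit i k * f k) = (\<Sum>k<n. if i = k then f k else 0)"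
    by (intro sum.cong) (auto simp: mat_unit_def)
  then show ?thesis using assms by simp
qed

lemma scaleC_diff_right: "cs_scaleC c (x - y) = cs_scaleC c x - cs_scaleC c (y::'a::cstar_algebra)"
  by (metis add_uminus_conv_diff scaleC_add_right scaleC_minus_right)

lemma scaleC_sum: "cs_scaleC c (\<Sum>i\<in>S. f i) = (\<Sum>i\<in>S. cs_scaleC c (f i :: 'a::cstar_algebra))"
  by (induction S rule: infinite_finite_induct) (auto simp: scaleC_add_right)

text \<open>The matrix is \<open>R\<^sup>* R\<close> for the row \<open>R = (X\<^sub>0, \<dots>)\<close>, so its spectrum agrees up to \<open>0\<close> with
  that of the single algebra element \<open>R R\<^sup>*\<close>.\<close>

lemma mat_positive_gram:
  fixes X :: "nat \<Rightarrow> 'a::cstar_algebra"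
  shows "mat_positive n (\<lambda>i j. cs_adj (X i) * X j)"
  unfolding mat_positive_def
proof (intro conjI allI impI ballI)
  fix i j show "cs_adj (X j) * X i = cs_adj (cs_adj (X i) * X j)" by (simp add: adj_mult adj_adj)
next
  fix c assume c: "c \<in> mat_spectrum n (\<lambda>i j. cs_adj (X i) * X j)"
  define R where "R = (\<Sum>k<n. X k * cs_adj (X k))"
  have R: "cs_positive R" unfolding R_def cs_positive_iff_sq_pos by (intro sq_pos_sum) simp
  have "c = 0 \<or> c \<in> cs_spectrum R"
  proof (rule ccontr)
    assume "\<not> (c = 0 \<or> c \<in> cs_spectrum R)"
    then obtain s where c0: "c \<noteq> 0"
      and s: "(R - cs_scaleC c 1) * s = 1" "s * (R - cs_scaleC c 1) = 1"
      by (auto simp: cs_spectrum_def cs_invertible_def)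
    have Rs: "R * s - cs_scaleC c s = 1" "s * R - cs_scaleC c s = 1"
      using s by (simp_all add: left_diff_distrib right_diff_distrib scaleC_mult_left scaleC_mult_right)
    let ?M = "\<lambda>i j. cs_adj (X i) * X j - cs_scaleC c (mat_unit i j)"
    \<comment> \<open>Rectangular analogue of \<open>invertible_swap\<close>: \<open>?N\<close> is
      the candidate inverse of \<open>?M\<close>, and both products reduce to the two equations for
      the inverse \<open>s\<close> of \<open>R - c\<close>.\<close>
    let ?B = "\<lambda>i j. cs_adj (X i) * s * X j - mat_unit i j"
    let ?N = "\<lambda>i j. cs_scaleC (inverse c) (?B i j)"
    have MB: "(\<Sum>k<n. ?M i k * ?B k j) = cs_scaleC c (mat_unit i j)" if "i < n" "j < n" for i j
    proof -
      have "(\<Sum>k<n. ?M i k * ?B k j) =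
          (\<Sum>k<n. cs_adj (X i) * (X k * cs_adj (X k)) * (s * X j))
          - (\<Sum>k<n. cs_adj (X i) * X k * mat_unit k j)
          - (\<Sum>k<n. mat_unit i k * cs_scaleC c (cs_adj (X k) * s * X j))
          + (\<Sum>k<n. mat_unit i k * cs_scaleC c (mat_unit k j))"
        by (simp add: left_diff_distrib right_diff_distrib sum_subtractf mult.assoc
            scaleC_mult_left scaleC_mult_right scaleC_diff_right)
      also have "\<dots> = cs_adj (X i) * R * (s * X j) - cs_adj (X i) * X j
          - cs_scaleC c (cs_adj (X i) * s * X j) + cs_scaleC c (mat_unit i j)"
        unfolding sum_mat_unit_left[OF that(1)] sum_mat_unit_right[OF that(2)] R_def
        by (simp add: sum_distrib_left sum_distrib_right)
      also have "cs_adj (X i) * R * (s * X j) - cs_adj (X i) * X j - cs_scaleC c (cs_adj (X i) * s * X j)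
          = cs_adj (X i) * (R * s - cs_scaleC c s - 1) * X j"
        by (simp add: left_diff_distrib right_diff_distrib mult.assoc scaleC_mult_left scaleC_mult_right)
      finally show ?thesis by (simp add: Rs)
    qed
    have BM: "(\<Sum>k<n. ?B i k * ?M k j) = cs_scaleC c (mat_unit i j)" if "i < n" "j < n" for i j
    proof -
      have "(\<Sum>k<n. ?B i k * ?M k j) =
          (\<Sum>k<n. cs_adj (X i) * s * (X k * cs_adj (X k)) * X j)
          - (\<Sum>k<n. cs_scaleC c (cs_adj (X i) * s * X k) * mat_unit k j)
          - (\<Sum>k<n. mat_unit i k * (cs_adj (X k) * X j))
          + (\<Sum>k<n. mat_unit i k * cs_scaleC c (mat_unit k j))"
        by (simp add: left_diff_distrib right_diff_distrib sum_subtractf mult.assoc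
            scaleC_mult_left scaleC_mult_right scaleC_diff_right)
      also have "\<dots> = cs_adj (X i) * s * R * X j - cs_scaleC c (cs_adj (X i) * s * X j)
          - cs_adj (X i) * X j + cs_scaleC c (mat_unit i j)"
        unfolding sum_mat_unit_left[OF that(1)] sum_mat_unit_right[OF that(2)] R_def
        by (simp add: sum_distrib_left sum_distrib_right)
      also have "cs_adj (X i) * s * R * X j - cs_scaleC c (cs_adj (X i) * s * X j) - cs_adj (X i) * X j
          = cs_adj (X i) * (s * R - cs_scaleC c s - 1) * X j"
        by (simp add: left_diff_distrib right_diff_distrib mult.assoc scaleC_mult_left scaleC_mult_right)
      finally show ?thesis by (simp add: Rs)
    qed
    have "mat_eq n (mat_mult n ?M ?N) mat_unit" "mat_eq n (mat_mult n ?N ?M) mat_unit"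
      unfolding mat_eq_def mat_mult_def scaleC_mult_left scaleC_mult_right scaleC_sum[symmetric]
      using c0 by (simp_all add: MB BM scaleC_scaleC scaleC_one)
    then show False using c unfolding mat_spectrum_def mat_invertible_def by blast
  qed
  then show "Im c = 0" "0 \<le> Re c" using R by (auto simp: cs_positive_def)
qed

text \<open>The algebra-valued inner product of the Hilbert module of columns.\<close>

definition col_inner :: "nat \<Rightarrow> (nat \<Rightarrow> 'a::cstar_algebra) \<Rightarrow> (nat \<Rightarrow> 'a) \<Rightarrow> 'a" where
  "col_inner n u v = (\<Sum>i<n. cs_adj (u i) * v i)"

definition mat_vec :: "nat \<Rightarrow> (nat \<Rightarrow> nat \<Rightarrow> 'a::cstar_algebra) \<Rightarrow> (nat \<Rightarrow> 'a) \<Rightarrow> nat \<Rightarrow> 'a" where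
  "mat_vec n M v = (\<lambda>i. \<Sum>k<n. M i k * v k)"

lemma col_inner_cong:
  "(\<And>i. i < n \<Longrightarrow> u i = u' i) \<Longrightarrow> (\<And>i. i < n \<Longrightarrow> v i = v' i) \<Longrightarrow> col_inner n u v = col_inner n u' v'"
  by (simp add: col_inner_def)

lemma col_inner_add_left: "col_inner n (\<lambda>i. u i + v i) w = col_inner n u w + col_inner n v w"
  by (simp add: col_inner_def adj_add distrib_right sum.distrib)

lemma col_inner_add_right: "col_inner n w (\<lambda>i. u i + v i) = col_inner n w u + col_inner n w v"
  by (simp add: col_inner_def distrib_left sum.distrib)

lemma col_inner_diff_left: "col_inner n (\<lambda>i. u i - v i) w = col_inner n u w - col_inner n v w"
  by (simp add: col_inner_def adj_diff left_diff_distrib sum_subtractf)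

lemma col_inner_diff_right: "col_inner n w (\<lambda>i. u i - v i) = col_inner n w u - col_inner n w v"
  by (simp add: col_inner_def right_diff_distrib sum_subtractf)

lemma col_inner_scaleR_left: "col_inner n (\<lambda>i. r *\<^sub>R u i) w = r *\<^sub>R col_inner n u w"
  by (simp add: col_inner_def scaleR_sum_right)

lemma col_inner_scaleR_right: "col_inner n w (\<lambda>i. r *\<^sub>R u i) = r *\<^sub>R col_inner n w u"
  by (simp add: col_inner_def scaleR_sum_right)

lemmas col_inner_simps = col_inner_add_left col_inner_add_right col_inner_diff_left
  col_inner_diff_right col_inner_scaleR_left col_inner_scaleR_right

lemma sq_pos_col_inner [simp]: "sq_pos (col_inner n v v)"
  unfolding col_inner_def by (intro sq_pos_sum) simp

lemma mat_vec_diff: "mat_vec n M (\<lambda>i. u i - v i) = (\<lambda>i. mat_vec n M u i - mat_vec n M v i)"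
  by (simp add: mat_vec_def right_diff_distrib sum_subtractf)

lemma mat_vec_scaleR: "mat_vec n M (\<lambda>i. r *\<^sub>R u i) = (\<lambda>i. r *\<^sub>R mat_vec n M u i)"
  by (simp add: mat_vec_def scaleR_sum_right)

lemma mat_vec_inverse:
  assumes "mat_eq n (mat_mult n M N) mat_unit" "i < n"
  shows "mat_vec n M (mat_vec n N v) i = v i"
proof -
  have "mat_vec n M (mat_vec n N v) i = (\<Sum>k<n. \<Sum>j<n. M i k * N k j * v j)"
    by (simp add: mat_vec_def sum_distrib_left mult.assoc)
  also have "\<dots> = (\<Sum>j<n. \<Sum>k<n. M i k * N k j * v j)"
    by (rule sum.swap)
  also have "\<dots> = (\<Sum>j<n. mat_mult n M N i j * v j)"
    by (simp add: mat_mult_def sum_distrib_right)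
  also have "\<dots> = (\<Sum>j<n. mat_unit i j * v j)"
    using assms by (intro sum.cong) (auto simp: mat_eq_def)
  also have "\<dots> = v i" using assms(2) by (rule sum_mat_unit_left)
  finally show ?thesis .
qed

lemma col_inner_mat_vec_hermitian:
  assumes "\<forall>i<n. \<forall>j<n. M j i = cs_adj (M i j)"
  shows "col_inner n u (mat_vec n M v) = col_inner n (mat_vec n M u) v"
proof -
  have "col_inner n u (mat_vec n M v) = (\<Sum>i<n. \<Sum>k<n. cs_adj (u i) * M i k * v k)"
    by (simp add: col_inner_def mat_vec_def sum_distrib_left mult.assoc)
  also have "\<dots> = (\<Sum>k<n. \<Sum>i<n. cs_adj (u i) * M i k * v k)"
    by (rule sum.swap)
  also have "\<dots> = (\<Sum>k<n. \<Sum>i<n. cs_adj (M k i * u i) * v k)"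
  proof (intro sum.cong refl)
    fix k i assume "k \<in> {..<n}" "i \<in> {..<n}"
    then have "M i k = cs_adj (M k i)" using assms by blast
    then show "cs_adj (u i) * M i k * v k = cs_adj (M k i * u i) * v k" by (simp add: adj_mult)
  qed
  also have "\<dots> = col_inner n (mat_vec n M u) v"
    by (simp add: col_inner_def mat_vec_def adj_sum sum_distrib_right)
  finally show ?thesis .
qed

text \<open>The parallelogram identity for the partial sum and the new term doubles the constant at
  each step, whence the crude \<open>2 ^ n\<close>.\<close>

lemma sq_pos_sum_bound:
  fixes x :: "nat \<Rightarrow> 'a::cstar_algebra"
  shows "sq_pos (2 ^ n *\<^sub>R (\<Sum>k<n. cs_adj (x k) * x k) - cs_adj (\<Sum>k<n. x k) * (\<Sum>k<n. x k))"
proof (induction n)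
  case (Suc n)
  define s where "s = (\<Sum>k<n. x k)"
  define q where "q = (\<Sum>k<n. cs_adj (x k) * x k)"
  have "sq_pos (2 *\<^sub>R (2 ^ n *\<^sub>R q - cs_adj s * s) + (2 ^ Suc n - 2) *\<^sub>R (cs_adj (x n) * x n)
      + cs_adj (s - x n) * (s - x n))"
    using Suc unfolding s_def q_def by (intro sq_pos_add sq_pos_scaleR) auto
  also have "2 *\<^sub>R (2 ^ n *\<^sub>R q - cs_adj s * s) + (2 ^ Suc n - 2) *\<^sub>R (cs_adj (x n) * x n)
      + cs_adj (s - x n) * (s - x n)
      = 2 ^ Suc n *\<^sub>R (q + cs_adj (x n) * x n) - cs_adj (s + x n) * (s + x n)"
    by (simp add: adj_add adj_diff algebra_simps scaleR_2)
  finally show ?case by (simp add: s_def q_def)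
qed simp

text \<open>Only the existence of a bound matters: \<open>K\<close> dominates every squared entry
  norm, \<open>2 ^ n\<close> comes from the sum within a row, and a factor \<open>n\<close> from
  adding the rows.\<close>

lemma mat_vec_bounded:
  fixes M :: "nat \<Rightarrow> nat \<Rightarrow> 'a::cstar_algebra"
  obtains C where "C \<ge> 0"
    "\<And>v. sq_pos (C *\<^sub>R col_inner n v v - col_inner n (mat_vec n M v) (mat_vec n M v))"
proof -
  define K where "K = (\<Sum>i<n. \<Sum>k<n. (norm (M i k))\<^sup>2)"
  have K0: "0 \<le> K" unfolding K_def by (intro sum_nonneg) auto
  have K: "(norm (M i k))\<^sup>2 \<le> K" if "i < n" "k < n" for i k
  proof -
    have "(norm (M i k))\<^sup>2 \<le> (\<Sum>k<n. (norm (M i k))\<^sup>2)"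
      using that by (intro member_le_sum) auto
    also have "\<dots> \<le> K" unfolding K_def
      using that by (intro member_le_sum[of i _ "\<lambda>i. \<Sum>k<n. (norm (M i k))\<^sup>2"] sum_nonneg) auto
    finally show ?thesis .
  qed
  have entry: "sq_pos (K *\<^sub>R (cs_adj y * y) - cs_adj (M i k * y) * (M i k * y))"
    if "i < n" "k < n" for i k y
  proof -
    have "sq_pos (K *\<^sub>R 1 - cs_adj (M i k) * M i k)"
      using K[OF that] by (intro sq_pos_norm_bound) (simp_all add: adj_mult adj_adj cstar_identity)
    from sq_pos_conj[OF this, of y] show ?thesis
      by (simp add: adj_mult right_diff_distrib left_diff_distrib mult.assoc)
  qed
  have row: "sq_pos ((2 ^ n * K) *\<^sub>R col_inner n v v - cs_adj (mat_vec n M v i) * mat_vec n M v i)"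
    if i: "i < n" for i v
  proof -
    have "sq_pos (\<Sum>k<n. K *\<^sub>R (cs_adj (v k) * v k) - cs_adj (M i k * v k) * (M i k * v k))"
      using i by (intro sq_pos_sum entry) auto
    then have "sq_pos (K *\<^sub>R col_inner n v v - (\<Sum>k<n. cs_adj (M i k * v k) * (M i k * v k)))"
      by (simp add: col_inner_def sum_subtractf scaleR_sum_right)
    then have "sq_pos (2 ^ n *\<^sub>R (K *\<^sub>R col_inner n v v - (\<Sum>k<n. cs_adj (M i k * v k) * (M i k * v k))))"
      by (rule sq_pos_scaleR) simp
    from sq_pos_add[OF this sq_pos_sum_bound[of n "\<lambda>k. M i k * v k"]] show ?thesis
      by (simp add: mat_vec_def scaleR_diff_right)
  qed
  have "sq_pos ((real n * (2 ^ n * K)) *\<^sub>R col_inner n v v - col_inner n (mat_vec n M v) (mat_vec n M v))" for v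
  proof -
    have "sq_pos (\<Sum>i<n. (2 ^ n * K) *\<^sub>R col_inner n v v - cs_adj (mat_vec n M v i) * mat_vec n M v i)"
      by (intro sq_pos_sum row) auto
    also have "(\<Sum>i<n. (2 ^ n * K) *\<^sub>R col_inner n v v - cs_adj (mat_vec n M v i) * mat_vec n M v i)
        = (real n * (2 ^ n * K)) *\<^sub>R col_inner n v v - col_inner n (mat_vec n M v) (mat_vec n M v)"
      by (simp add: sum_subtractf sum_constant_scaleR col_inner_def[of n "mat_vec n M v"] del: sum_constant)
    finally show ?thesis .
  qed
  then show ?thesis using K0 by (intro that[of "real n * (2 ^ n * K)"]) auto
qed

text \<open>Expanding the inner squares of \<open>v - M v\<close> and \<open>v + M v\<close> bounds
  twice the form, up to sign, by the inner squares of \<open>v\<close> and \<open>M v\<close>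
  together; hence the constant \<open>(C + 1) / 2\<close>.\<close>

lemma mat_form_bounded:
  fixes M :: "nat \<Rightarrow> nat \<Rightarrow> 'a::cstar_algebra"
  assumes sym: "\<And>u v. col_inner n u (mat_vec n M v) = col_inner n (mat_vec n M u) v"
  obtains C where "C > 0"
    "\<And>v. sq_pos (C *\<^sub>R col_inner n v v - col_inner n v (mat_vec n M v))"
    "\<And>v. sq_pos (col_inner n v (mat_vec n M v) + C *\<^sub>R col_inner n v v)"
proof -
  obtain C where C: "C \<ge> 0"
    "\<And>v. sq_pos (C *\<^sub>R col_inner n v v - col_inner n (mat_vec n M v) (mat_vec n M v))"
    using mat_vec_bounded[of n M] by blast
  show ?thesis
  proof (rule that[of "(C + 1) / 2"])
    fix v
    let ?x = "col_inner n v v" and ?y = "col_inner n v (mat_vec n M v)"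
      and ?w = "col_inner n (mat_vec n M v) (mat_vec n M v)"
    have half: "sq_pos z" if "sq_pos (z + z)" for z :: 'a
      using sq_pos_scaleR[OF that, of "1/2"] by simp
    have two: "((C + 1) / 2) *\<^sub>R ?x + ((C + 1) / 2) *\<^sub>R ?x = C *\<^sub>R ?x + ?x"
    proof -
      have "((C + 1) / 2) *\<^sub>R ?x + ((C + 1) / 2) *\<^sub>R ?x = (C + 1) *\<^sub>R ?x"
        by (simp flip: scaleR_left_distrib)
      then show ?thesis by (simp only: scaleR_left_distrib scaleR_one)
    qed
    have "sq_pos ((C *\<^sub>R ?x - ?w) + col_inner n (\<lambda>i. v i - mat_vec n M v i) (\<lambda>i. v i - mat_vec n M v i))"
      by (intro sq_pos_add C) simp
    also have "col_inner n (\<lambda>i. v i - mat_vec n M v i) (\<lambda>i. v i - mat_vec n M v i) = ?x - ?y - (?y - ?w)"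
      by (simp add: col_inner_simps sym)
    also have "(C *\<^sub>R ?x - ?w) + (?x - ?y - (?y - ?w))
        = (((C + 1) / 2) *\<^sub>R ?x - ?y) + (((C + 1) / 2) *\<^sub>R ?x - ?y)"
      using two by (simp add: algebra_simps)
    finally show "sq_pos (((C + 1) / 2) *\<^sub>R ?x - ?y)" by (rule half)
    have "sq_pos ((C *\<^sub>R ?x - ?w) + col_inner n (\<lambda>i. v i + mat_vec n M v i) (\<lambda>i. v i + mat_vec n M v i))"
      by (intro sq_pos_add C) simp
    also have "col_inner n (\<lambda>i. v i + mat_vec n M v i) (\<lambda>i. v i + mat_vec n M v i) = ?x + ?y + (?y + ?w)"
      by (simp add: col_inner_simps sym)
    also have "(C *\<^sub>R ?x - ?w) + (?x + ?y + (?y + ?w))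
        = (?y + ((C + 1) / 2) *\<^sub>R ?x) + (?y + ((C + 1) / 2) *\<^sub>R ?x)"
      using two by (simp add: algebra_simps)
    finally show "sq_pos (?y + ((C + 1) / 2) *\<^sub>R ?x)" by (rule half)
  qed (use C in simp)
qed

text \<open>If \<open>K \<ge> 0\<close> and \<open>L = C - K \<ge> 0\<close>, then \<open>C K L = K L K + L K L \<ge> 0\<close>, that is, \<open>K\<^sup>2 \<le> C K\<close>;
  conjugating by \<open>H = K\<^sup>-\<^sup>1\<close> gives \<open>1 \<le> C H\<close>.\<close>

lemma positive_form_bounded_below:
  fixes H K :: "nat \<Rightarrow> nat \<Rightarrow> 'a::cstar_algebra"
  assumes sym: "\<And>u v. col_inner n u (mat_vec n H v) = col_inner n (mat_vec n H u) v"
    and pos: "\<And>v. sq_pos (col_inner n v (mat_vec n H v))"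
    and HK: "mat_eq n (mat_mult n H K) mat_unit" and KH: "mat_eq n (mat_mult n K H) mat_unit"
  obtains e where "e > 0" "\<And>v. sq_pos (col_inner n v (mat_vec n H v) - e *\<^sub>R col_inner n v v)"
proof -
  let ?h = "mat_vec n H" and ?k = "mat_vec n K" and ?ip = "col_inner n"
  have hk: "?h (?k v) i = v i" and kh: "?k (?h v) i = v i" if "i < n" for i v
    using HK KH that by (simp_all add: mat_vec_inverse)
  have ksym: "?ip u (?k v) = ?ip (?k u) v" for u v
  proof -
    have "?ip u (?k v) = ?ip (?h (?k u)) (?k v)" by (intro col_inner_cong) (simp_all add: hk)
    also have "\<dots> = ?ip (?k u) (?h (?k v))" by (simp add: sym)
    also have "\<dots> = ?ip (?k u) v" by (intro col_inner_cong) (simp_all add: hk)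
    finally show ?thesis .
  qed
  have kpos: "sq_pos (?ip v (?k v))" for v
  proof -
    have "?ip v (?k v) = ?ip (?k v) (?h (?k v))"
      unfolding ksym[of v v] by (intro col_inner_cong) (simp_all add: hk)
    then show ?thesis using pos by simp
  qed
  obtain C where C: "C > 0" "\<And>v. sq_pos (C *\<^sub>R ?ip v v - ?ip v (?k v))"
    using mat_form_bounded[of n K, OF ksym] by metis
  have main: "sq_pos (C *\<^sub>R ?ip v (?k v) - ?ip (?k v) (?k v))" for v
  proof -
    let ?w = "?k v" and ?y = "\<lambda>i. C *\<^sub>R v i - ?k v i"
    \<comment> \<open>With \<open>L = C - K\<close>, the two summands are the forms of
      \<open>K L K\<close> and \<open>L K L\<close> at \<open>v\<close>.\<close>
    have "sq_pos ((C *\<^sub>R ?ip ?w ?w - ?ip ?w (?k ?w)) + ?ip ?y (?k ?y))"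
      by (intro sq_pos_add C kpos)
    also have "?ip ?y (?k ?y) = C *\<^sub>R C *\<^sub>R ?ip v ?w - C *\<^sub>R ?ip ?w ?w
        - C *\<^sub>R ?ip v (?k ?w) + ?ip ?w (?k ?w)"
      by (simp add: mat_vec_diff mat_vec_scaleR col_inner_simps algebra_simps)
    also have "?ip v (?k ?w) = ?ip ?w ?w" by (rule ksym)
    finally have "sq_pos (C *\<^sub>R (C *\<^sub>R ?ip v ?w - ?ip ?w ?w))"
      by (simp add: scaleR_diff_right)
    from sq_pos_scaleR[OF this, of "1/C"] show ?thesis using C(1) by simp
  qed
  have "sq_pos (?ip v (?h v) - (1/C) *\<^sub>R ?ip v v)" for v
  proof -
    have 1: "?ip (?h v) (?k (?h v)) = ?ip v (?h v)" unfolding sym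
      by (intro col_inner_cong) (simp_all add: kh)
    have 2: "?ip (?k (?h v)) (?k (?h v)) = ?ip v v"
      by (intro col_inner_cong) (simp_all add: kh)
    from sq_pos_scaleR[OF main[of "?h v"], of "1/C"] show ?thesis
      unfolding 1 2 using C(1) by (simp add: scaleR_diff_right)
  qed
  then show ?thesis using C(1) by (intro that[of "1/C"]) simp_all
qed

text \<open>The continuity method for the form of \<open>M + t\<close>. Since \<open>- t\<close>
  lies outside the spectrum, \<open>M + t\<close> is invertible, so its nonnegative form is bounded
  below by some \<open>e > 0\<close> and \<open>t\<close> can be decreased.\<close>

lemma mat_positive_form:
  fixes M :: "nat \<Rightarrow> nat \<Rightarrow> 'a::cstar_algebra"
  assumes M: "mat_positive n M"
  shows "sq_pos (col_inner n v (mat_vec n M v))"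
proof -
  let ?P = "\<lambda>t. \<forall>v. sq_pos (col_inner n v (mat_vec n M v) + t *\<^sub>R col_inner n v v)"
  have herm: "\<forall>i<n. \<forall>j<n. M j i = cs_adj (M i j)" using M unfolding mat_positive_def by blast
  note sym = col_inner_mat_vec_hermitian[OF herm]
  obtain C where C: "\<And>v. sq_pos (col_inner n v (mat_vec n M v) + C *\<^sub>R col_inner n v v)"
    using mat_form_bounded[of n M, OF sym] by blast
  have "?P 0"
  proof (rule upward_closed_open_imp_zero[of ?P C])
    fix s t :: real assume s: "?P s" and st: "s \<le> t"
    show "?P t"
    proof
      fix v
      have "sq_pos ((col_inner n v (mat_vec n M v) + s *\<^sub>R col_inner n v v) + (t - s) *\<^sub>R col_inner n v v)"
        by (rule sq_pos_add) (use s st in \<open>auto intro: sq_pos_scaleR\<close>)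
      then show "sq_pos (col_inner n v (mat_vec n M v) + t *\<^sub>R col_inner n v v)"
        by (simp add: add.assoc flip: scaleR_left_distrib)
    qed
  next
    show "?P C" using C by blast
  next
    fix t :: real assume *: "\<And>e. e > 0 \<Longrightarrow> ?P (t + e)"
    show "?P t"
    proof
      fix v
      show "sq_pos (col_inner n v (mat_vec n M v) + t *\<^sub>R col_inner n v v)"
        by (rule sq_pos_closed[of _ "col_inner n v v"])
          (use * in \<open>simp add: scaleR_left_distrib add.assoc\<close>)
    qed
  next
    fix t :: real assume t: "t > 0" and P: "?P t"
    define H where "H = (\<lambda>i j. M i j + t *\<^sub>R mat_unit i j)"
    have "\<forall>c\<in>mat_spectrum n M. 0 \<le> Re c"
      using M unfolding mat_positive_def by blast
    then have "complex_of_real (- t) \<notin> mat_spectrum n M"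
      using t by force
    then have "mat_invertible n H"
      unfolding mat_spectrum_def mem_Collect_eq scaleC_of_real H_def by simp
    then obtain K where K: "mat_eq n (mat_mult n H K) mat_unit" "mat_eq n (mat_mult n K H) mat_unit"
      unfolding mat_invertible_def by blast
    have "\<forall>i<n. \<forall>j<n. H j i = cs_adj (H i j)"
    proof (intro allI impI)
      fix i j assume "i < n" "j < n"
      then have "M j i = cs_adj (M i j)" using herm by blast
      then show "H j i = cs_adj (H i j)" by (simp add: H_def adj_add adj_mat_unit)
    qed
    note symH = col_inner_mat_vec_hermitian[OF this]
    have Hv: "mat_vec n H v i = mat_vec n M v i + t *\<^sub>R v i" if "i < n" for v i
      using that by (simp add: mat_vec_def H_def distrib_right sum.distrib sum_mat_unit_left
          flip: scaleR_sum_right)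
    have form: "col_inner n v (mat_vec n H v) = col_inner n v (mat_vec n M v) + t *\<^sub>R col_inner n v v" for v
    proof -
      have "col_inner n v (mat_vec n H v) = col_inner n v (\<lambda>i. mat_vec n M v i + t *\<^sub>R v i)"
        by (intro col_inner_cong) (simp_all add: Hv)
      then show ?thesis by (simp add: col_inner_simps)
    qed
    have posH: "sq_pos (col_inner n v (mat_vec n H v))" for v
      using P by (simp add: form)
    obtain e where e: "e > 0" "\<And>v. sq_pos (col_inner n v (mat_vec n H v) - e *\<^sub>R col_inner n v v)"
      using positive_form_bounded_below[OF symH posH K] by blast
    then show "\<exists>e>0. ?P (t - e)"
      by (intro exI[of _ e]) (simp add: form scaleR_left_diff_distrib add_diff_eq)
  qed
  then show ?thesis by simp
qed

subsection \<open>Three-positive maps\<close>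

lemma sum_lessThan_3:
  fixes f :: "nat \<Rightarrow> 'a::comm_monoid_add"
  assumes "3 \<le> n" "\<And>k. 3 \<le> k \<Longrightarrow> f k = 0"
  shows "sum f {..<n} = f 0 + f 1 + f 2"
proof -
  have "sum f {..<n} = sum f {..<3}"
    using assms by (intro sum.mono_neutral_right) auto
  then show ?thesis by (simp add: eval_nat_numeral)
qed

lemma n_positive_form_3:
  fixes \<Phi> :: "'a::cstar_algebra \<Rightarrow> 'b::cstar_algebra"
  assumes \<Phi>: "n_positive n \<Phi>" and n: "3 \<le> n"
  shows "sq_pos (
      cs_adj x * (\<Phi> (cs_adj X * X) * x + \<Phi> (cs_adj X * Y) * y + \<Phi> (cs_adj X * Z) * z) +
      cs_adj y * (\<Phi> (cs_adj Y * X) * x + \<Phi> (cs_adj Y * Y) * y + \<Phi> (cs_adj Y * Z) * z) +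
      cs_adj z * (\<Phi> (cs_adj Z * X) * x + \<Phi> (cs_adj Z * Y) * y + \<Phi> (cs_adj Z * Z) * z))"
proof -
  define U where "U = (\<lambda>i::nat. if i = 0 then X else if i = 1 then Y else Z)"
  \<comment> \<open>Zero from index 3 on, so only the leading 3 by 3 block contributes, whatever
    \<open>U\<close> is beyond it.\<close>
  define v where "v = (\<lambda>i::nat. if i = 0 then x else if i = 1 then y else if i = 2 then z else 0)"
  let ?M = "\<lambda>i j. \<Phi> (cs_adj (U i) * U j)"
  have v0: "v k = 0" if "3 \<le> k" for k using that by (simp add: v_def)
  have "mat_positive n ?M"
    using \<Phi> mat_positive_gram[of n U] unfolding n_positive_def by blast
  then have "sq_pos (col_inner n v (mat_vec n ?M v))" by (rule mat_positive_form)
  then show ?thesis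
    by (simp add: col_inner_def mat_vec_def sum_lessThan_3[OF n] v0) (simp add: v_def U_def)
qed

text \<open>Positive matrices are hermitian; this compares two opposite off-diagonal entries in the
  image of the Gram matrix of \<open>1, X, X, ...\<close>.\<close>

lemma n_positive_adj:
  fixes \<Phi> :: "'a::cstar_algebra \<Rightarrow> 'b::cstar_algebra"
  assumes \<Phi>: "n_positive n \<Phi>" and n: "3 \<le> n"
  shows "\<Phi> (cs_adj X) = cs_adj (\<Phi> X)"
proof -
  define U where "U = (\<lambda>i::nat. if i = 0 then 1 else X)"
  have "mat_positive n (\<lambda>i j. \<Phi> (cs_adj (U i) * U j))"
    using \<Phi> mat_positive_gram[of n U] unfolding n_positive_def by blast
  moreover have "0 < n" "1 < n" using n by simp_all
  ultimately have "\<Phi> (cs_adj (U 1) * U 0) = cs_adj (\<Phi> (cs_adj (U 0) * U 1))"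
    unfolding mat_positive_def by blast
  then show ?thesis by (simp add: U_def)
qed

lemma n_positive_adj_mult:
  fixes \<Phi> :: "'a::cstar_algebra \<Rightarrow> 'b::cstar_algebra"
  assumes \<Phi>: "n_positive n \<Phi>" and n: "3 \<le> n"
  shows "sq_pos (\<Phi> (cs_adj X * X))"
  using n_positive_form_3[OF assms, of 1 X X 0 X 0] by simp

text \<open>\<open>(norm X)\<^sup>2 - X\<^sup>* X\<close> has the form \<open>r\<^sup>* r\<close>,
  so its image is positive, and unitality preserves the scalar.\<close>

lemma norm_n_positive_adj_mult_le:
  fixes \<Phi> :: "'a::cstar_algebra \<Rightarrow> 'b::cstar_algebra"
  assumes lin: "complex_linear_map \<Phi>" and unit: "unital_map \<Phi>"
    and \<Phi>: "n_positive n \<Phi>" and n: "3 \<le> n"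
  shows "norm (\<Phi> (cs_adj X * X)) \<le> (norm X)\<^sup>2"
proof (rule norm_le_of_order_unit)
  show "sq_pos (\<Phi> (cs_adj X * X))" using \<Phi> n by (rule n_positive_adj_mult)
  have "sq_pos ((norm X)\<^sup>2 *\<^sub>R 1 - cs_adj X * X)"
    by (intro sq_pos_norm_bound) (simp_all add: adj_mult adj_adj cstar_identity)
  then obtain r where r: "cs_adj r = r" "r * r = (norm X)\<^sup>2 *\<^sub>R 1 - cs_adj X * X"
    unfolding sq_pos_def by blast
  have add: "\<Phi> (a + b) = \<Phi> a + \<Phi> b" and scale: "\<Phi> (s *\<^sub>R a) = s *\<^sub>R \<Phi> a" for a b s
    using lin unfolding complex_linear_map_def by (blast, metis scaleC_of_real)
  have "\<Phi> (r * r) + \<Phi> (cs_adj X * X) = (norm X)\<^sup>2 *\<^sub>R 1"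
    using unit by (simp add: r(2) scale unital_map_def flip: add)
  then have "\<Phi> (cs_adj r * r) = (norm X)\<^sup>2 *\<^sub>R 1 - \<Phi> (cs_adj X * X)"
    by (simp add: r(1) eq_diff_eq)
  then show "sq_pos ((norm X)\<^sup>2 *\<^sub>R 1 - \<Phi> (cs_adj X * X))"
    using n_positive_adj_mult[OF \<Phi> n, of r] by simp
qed simp

text \<open>Serves to take the two infima one at a time; \<open>c = 0\<close> is separate because
  the argument divides by \<open>c\<close>.\<close>

lemma le_mult_INF:
  fixes t c :: real
  assumes "\<And>x. t \<le> c * g x" "0 \<le> c" "\<And>x. 0 \<le> g x"
  shows "t \<le> c * (INF x. g x)"
proof (cases "c = 0")
  case True
  then show ?thesis using assms(1) by simp
next
  case False
  then have "t / c \<le> (INF x. g x)"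
    using assms by (intro cINF_greatest) (simp_all add: field_simps)
  then show ?thesis using False assms(2) by (simp add: field_simps)
qed

text \<open>The positive form of \<open>[\<Phi>(X\<^sub>i\<^sup>* X\<^sub>j)]\<close> for \<open>X = (A\<^sup>*, B, 1)\<close> is evaluated at the column
  \<open>(-s T, 1, z)\<close>, where \<open>z\<close> is chosen to annihilate the last row (a Schur complement) and
  \<open>s = 1 / \<kappa>\<close> for an upper bound \<open>\<kappa>\<close> of \<open>\<Phi>(A A\<^sup>*)\<close>.\<close>

lemma covariance_bound:
  fixes \<Phi> :: "'a::cstar_algebra \<Rightarrow> 'b::cstar_algebra"
  assumes unit: "unital_map \<Phi>" and \<Phi>: "n_positive n \<Phi>" and n: "3 \<le> n"
  defines "T \<equiv> \<lambda>A B. \<Phi> (A * B) - \<Phi> A * \<Phi> B"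
  shows "sq_pos (norm (\<Phi> (A * cs_adj A)) *\<^sub>R \<Phi> (cs_adj B * B) - cs_adj (T A B) * T A B)"
proof (rule sq_pos_closed[of _ "\<Phi> (cs_adj B * B)"])
  fix e :: real assume e: "e > 0"
  define p q c a b S where "p = \<Phi> (A * cs_adj A)" and "q = \<Phi> (cs_adj B * B)" and "c = \<Phi> (A * B)"
    and "a = \<Phi> A" and "b = \<Phi> B" and "S = T A B"
  have S: "S = c - a * b" by (simp add: S_def T_def c_def a_def b_def)
  have Phi: "\<Phi> (cs_adj B * cs_adj A) = cs_adj c" "\<Phi> (cs_adj A) = cs_adj a" "\<Phi> (cs_adj B) = cs_adj b"
    "\<Phi> 1 = 1"
    using n_positive_adj[OF \<Phi> n, of "A * B"] n_positive_adj[OF \<Phi> n] unit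
    by (simp_all add: adj_mult c_def a_def b_def unital_map_def)
  \<comment> \<open>The summand \<open>e\<close> keeps \<open>k\<close> positive even if
    \<open>p = 0\<close>; the error \<open>e *\<^sub>R q\<close> it causes is removed by
    \<open>sq_pos_closed\<close>.\<close>
  define k where "k = norm p + e"
  have k: "k > 0" using e by (simp add: k_def add_nonneg_pos)
  define s where "s = 1 / k"
  have s: "s > 0" "s * k = 1" using k by (simp_all add: s_def)
  let ?x = "- (s *\<^sub>R S)"
  let ?z = "- (cs_adj a * ?x + b)"
  have "sq_pos (cs_adj ?x * (p * ?x + c * 1 + a * ?z) + cs_adj 1 * (cs_adj c * ?x + q * 1 + cs_adj b * ?z)
      + cs_adj ?z * (cs_adj a * ?x + b * 1 + 1 * ?z))"
    using n_positive_form_3[OF \<Phi> n, of ?x "cs_adj A" B 1 1 ?z]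
    by (simp add: adj_adj Phi flip: p_def q_def c_def a_def b_def)
  also have "cs_adj ?x * (p * ?x + c * 1 + a * ?z) + cs_adj 1 * (cs_adj c * ?x + q * 1 + cs_adj b * ?z)
      + cs_adj ?z * (cs_adj a * ?x + b * 1 + 1 * ?z)
      = cs_adj ?x * (p * ?x + S - a * (cs_adj a * ?x)) + cs_adj S * ?x + q - cs_adj b * b"
    by (simp add: S adj_diff adj_mult algebra_simps)
  also have "\<dots> = (s * s) *\<^sub>R (cs_adj S * p * S) - (s * s) *\<^sub>R (cs_adj (cs_adj a * S) * (cs_adj a * S))
      - s *\<^sub>R (cs_adj S * S) - s *\<^sub>R (cs_adj S * S) + q - cs_adj b * b"
    by (simp add: adj_adj adj_mult algebra_simps)
  finally have 1: "sq_pos ((s * s) *\<^sub>R (cs_adj S * p * S) - (s * s) *\<^sub>R (cs_adj (cs_adj a * S) * (cs_adj a * S))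
      - s *\<^sub>R (cs_adj S * S) - s *\<^sub>R (cs_adj S * S) + q - cs_adj b * b)" .
  have "sq_pos p"
    using n_positive_adj_mult[OF \<Phi> n, of "cs_adj A"] by (simp add: adj_adj p_def)
  then have "sq_pos (k *\<^sub>R 1 - p)" using e by (intro sq_pos_norm_bound) (simp_all add: sq_pos_sa k_def)
  from sq_pos_conj[OF this, of S] have "sq_pos (k *\<^sub>R (cs_adj S * S) - cs_adj S * p * S)"
    by (simp add: left_diff_distrib right_diff_distrib)
  then have 2: "sq_pos ((s * s) *\<^sub>R (k *\<^sub>R (cs_adj S * S) - cs_adj S * p * S))"
    by (rule sq_pos_scaleR) simp
  \<comment> \<open>Adding these squares back replaces the diagonal entries
    \<open>p - a a\<^sup>*\<close> and \<open>q - b\<^sup>* b\<close> of the Schur complement by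
    \<open>p\<close> and \<open>q\<close>.\<close>
  have 3: "sq_pos ((s * s) *\<^sub>R (cs_adj (cs_adj a * S) * (cs_adj a * S)) + cs_adj b * b)"
    by (intro sq_pos_add sq_pos_scaleR) simp_all
  \<comment> \<open>As \<open>p \<le> k\<close>, the term with \<open>p\<close> is now at most one
    of the two copies of \<open>s *\<^sub>R (cs_adj S * S)\<close> that are subtracted; the other
    copy survives.\<close>
  have "s * s * k = s" using s(2) by simp
  with 2 have "sq_pos (s *\<^sub>R (cs_adj S * S) - (s * s) *\<^sub>R (cs_adj S * p * S))"
    by (simp only: scaleR_diff_right scaleR_scaleR)
  from sq_pos_add[OF sq_pos_add[OF 1 this] 3] have "sq_pos (q - s *\<^sub>R (cs_adj S * S))"
    by (simp add: algebra_simps)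
  then have "sq_pos (k *\<^sub>R (q - s *\<^sub>R (cs_adj S * S)))" using k by (intro sq_pos_scaleR) auto
  also have "k *\<^sub>R (q - s *\<^sub>R (cs_adj S * S)) = norm p *\<^sub>R q - cs_adj S * S + e *\<^sub>R q"
    using s(2) by (simp add: scaleR_diff_right mult.commute) (simp add: k_def scaleR_left_distrib)
  finally show "sq_pos (norm (\<Phi> (A * cs_adj A)) *\<^sub>R \<Phi> (cs_adj B * B) - cs_adj (T A B) * T A B
      + e *\<^sub>R \<Phi> (cs_adj B * B))"
    unfolding p_def q_def S_def .
qed

text \<open>By linearity and unitality, the terms containing \<alpha> or \<beta> are the same in the
  image of the product and in the product of the images.\<close>

lemma covariance_shift:
  fixes \<Phi> :: "'a::cstar_algebra \<Rightarrow> 'b::cstar_algebra"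
  assumes lin: "complex_linear_map \<Phi>" and unit: "unital_map \<Phi>"
  shows "\<Phi> ((A - cs_scaleC \<alpha> 1) * (B - cs_scaleC \<beta> 1)) - \<Phi> (A - cs_scaleC \<alpha> 1) * \<Phi> (B - cs_scaleC \<beta> 1)
    = \<Phi> (A * B) - \<Phi> A * \<Phi> B"
proof -
  have add: "\<Phi> (a + b) = \<Phi> a + \<Phi> b" and scale: "\<Phi> (cs_scaleC r a) = cs_scaleC r (\<Phi> a)" for a b r
    using lin unfolding complex_linear_map_def by blast+
  have diff: "\<Phi> (a - b) = \<Phi> a - \<Phi> b" for a b using add[of "a - b" b] by simp
  show ?thesis using unit
    by (simp add: left_diff_distrib right_diff_distrib scaleC_mult_left scaleC_mult_right
        diff scale unital_map_def scaleC_diff_right)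
qed

theorem theorem3p5:
  fixes \<Phi> :: "'a::cstar_algebra \<Rightarrow> 'b::cstar_algebra" and n :: nat
  assumes "complex_linear_map \<Phi>" and "unital_map \<Phi>"
    and "n \<ge> 3" and "n_positive n \<Phi>"
  shows "(\<forall>A B :: 'a. \<forall>\<alpha> \<beta> :: complex.
            cs_le (cs_abs (\<Phi> (A * B) - \<Phi> A * \<Phi> B))
              (scaleR (sqrt (norm (\<Phi> ((cs_abs (cs_adj A - cs_scaleC \<alpha> 1))\<^sup>2))))
                 (cs_sqrt (\<Phi> ((cs_abs (B - cs_scaleC \<beta> 1))\<^sup>2)))))
       \<and> (\<forall>A B :: 'a.
            norm (\<Phi> (A * B) - \<Phi> A * \<Phi> B)
              \<le> (INF \<alpha>. norm (A - cs_scaleC \<alpha> 1)) * (INF \<beta>. norm (B - cs_scaleC \<beta> 1)))"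
proof (intro conjI allI)
  fix A B :: 'a and \<alpha> \<beta> :: complex
  \<comment> \<open>The conjugate appears because \<open>A\<^sup>* - \<alpha>\<close> is the adjoint
    of \<open>A - cnj \<alpha>\<close>.\<close>
  define A' B' where "A' = A - cs_scaleC (cnj \<alpha>) 1" and "B' = B - cs_scaleC \<beta> 1"
  define T where "T = \<Phi> (A * B) - \<Phi> A * \<Phi> B"
  define k q where "k = norm (\<Phi> (A' * cs_adj A'))" and "q = \<Phi> (cs_adj B' * B')"
  have adjA: "cs_adj A - cs_scaleC \<alpha> 1 = cs_adj A'"
    by (simp add: A'_def adj_diff adj_scaleC)
  have T: "T = \<Phi> (A' * B') - \<Phi> A' * \<Phi> B'"
    unfolding A'_def B'_def T_def covariance_shift[OF assms(1,2)] ..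
  have le: "sq_pos (k *\<^sub>R q - cs_adj T * T)"
    unfolding T k_def q_def using assms(2,4,3) by (rule covariance_bound)
  have q: "cs_positive q"
    unfolding q_def cs_positive_iff_sq_pos using assms(4,3) by (rule n_positive_adj_mult)
  have "sq_pos (sqrt k *\<^sub>R cs_sqrt q - cs_abs T)"
  proof (rule sq_pos_sqrt_mono)
    show "sq_pos (cs_abs T)"
      unfolding cs_abs_def cs_positive_iff_sq_pos[symmetric]
      by (rule cs_sqrt_works) (simp add: cs_positive_iff_sq_pos)
    show "sq_pos (sqrt k *\<^sub>R cs_sqrt q)"
      using cs_sqrt_works(1)[OF q]
      by (intro sq_pos_scaleR) (simp_all add: cs_positive_iff_sq_pos k_def)
    have "(sqrt k *\<^sub>R cs_sqrt q) * (sqrt k *\<^sub>R cs_sqrt q) = k *\<^sub>R q"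
      by (simp add: cs_sqrt_works(2)[OF q] k_def)
    then show "sq_pos ((sqrt k *\<^sub>R cs_sqrt q) * (sqrt k *\<^sub>R cs_sqrt q) - cs_abs T * cs_abs T)"
      using le cs_abs_square[of T] by (simp add: power2_eq_square)
  qed
  then show "cs_le (cs_abs (\<Phi> (A * B) - \<Phi> A * \<Phi> B))
      (scaleR (sqrt (norm (\<Phi> ((cs_abs (cs_adj A - cs_scaleC \<alpha> 1))\<^sup>2))))
        (cs_sqrt (\<Phi> ((cs_abs (B - cs_scaleC \<beta> 1))\<^sup>2))))"
    unfolding cs_le_def cs_positive_iff_sq_pos cs_abs_square adjA adj_adj
    by (simp only: k_def q_def T_def B'_def)
next
  fix A B :: 'a
  define T where "T = \<Phi> (A * B) - \<Phi> A * \<Phi> B"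
  have bound: "norm T \<le> norm (A - cs_scaleC \<alpha> 1) * norm (B - cs_scaleC \<beta> 1)" for \<alpha> \<beta>
  proof -
    define A' B' where "A' = A - cs_scaleC \<alpha> 1" and "B' = B - cs_scaleC \<beta> 1"
    define k q where "k = norm (\<Phi> (A' * cs_adj A'))" and "q = \<Phi> (cs_adj B' * B')"
    have T: "T = \<Phi> (A' * B') - \<Phi> A' * \<Phi> B'"
      unfolding A'_def B'_def T_def covariance_shift[OF assms(1,2)] ..
    have le: "sq_pos (k *\<^sub>R q - cs_adj T * T)"
      unfolding T k_def q_def using assms(2,4,3) by (rule covariance_bound)
    have q: "sq_pos q"
      unfolding q_def using assms(4,3) by (rule n_positive_adj_mult)
    have kn: "k \<le> (norm A')\<^sup>2"
      using norm_n_positive_adj_mult_le[OF assms(1,2,4,3), of "cs_adj A'"] by (simp add: adj_adj k_def)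
    have qn: "norm q \<le> (norm B')\<^sup>2"
      unfolding q_def using assms(1,2,4,3) by (rule norm_n_positive_adj_mult_le)
    \<comment> \<open>The norm bound is drawn from
      \<open>T\<^sup>* T \<le> k q \<le> k * norm q\<close> and the C*-identity, without passing
      through \<open>cs_abs T\<close>.\<close>
    have "sq_pos (k *\<^sub>R (norm q *\<^sub>R 1 - q))"
      by (intro sq_pos_scaleR sq_pos_norm_bound) (simp_all add: sq_pos_sa[OF q] k_def)
    from sq_pos_add[OF this le] have "sq_pos ((k * norm q) *\<^sub>R 1 - cs_adj T * T)"
      by (simp add: scaleR_diff_right)
    then have "norm (cs_adj T * T) \<le> k * norm q"
      by (intro norm_le_of_order_unit) (simp_all add: k_def)
    also have "\<dots> \<le> (norm A')\<^sup>2 * (norm B')\<^sup>2"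
      using kn qn by (intro mult_mono) simp_all
    finally have "(norm T)\<^sup>2 \<le> (norm A' * norm B')\<^sup>2"
      by (simp add: cstar_identity power_mult_distrib)
    then show ?thesis unfolding A'_def B'_def by (rule power2_le_imp_le) simp
  qed
  let ?f = "\<lambda>\<alpha>. norm (A - cs_scaleC \<alpha> 1)" and ?g = "\<lambda>\<beta>. norm (B - cs_scaleC \<beta> 1)"
  have "norm T \<le> ?f \<alpha> * (INF \<beta>. ?g \<beta>)" for \<alpha>
    by (rule le_mult_INF) (simp_all add: bound)
  moreover have "0 \<le> (INF \<beta>. ?g \<beta>)" by (rule cINF_greatest) simp_all
  ultimately have "norm T \<le> (INF \<beta>. ?g \<beta>) * (INF \<alpha>. ?f \<alpha>)"
    by (intro le_mult_INF) (simp_all add: mult.commute)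
  then show "norm (\<Phi> (A * B) - \<Phi> A * \<Phi> B) \<le> (INF \<alpha>. ?f \<alpha>) * (INF \<beta>. ?g \<beta>)"
    by (simp add: T_def mult.commute)
qed

end
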